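(* Let $\lambda_i^{(a)}$, $i=1,2,3$, $a=1,2,3$, be nine nonnegative real numbers satisfying $\lambda_1^{(a)}\le\lambda_2^{(a)}\le\lambda_3^{(a)}$ and $\lambda_1^{(a)}+\lambda_2^{(a)}+\lambda_3^{(a)}=1$ for each $a$. Then there exists a (pure) three-qutrit state such that, for each $a=1,2,3$, the eigenvalues (with multiplicity) of its $a$th reduced density matrix are $\lambda_1^{(a)},\lambda_2^{(a)},\lambda_3^{(a)}$ if and only if the following inequalities hold for every permutation $(a,b,c)$ of $(1,2,3)$: \begin{align*} (1)\quad \lambda_2^{(a)} + \lambda_1^{(a)} &\le \lambda_2^{(b)} + \lambda_1^{(b)} + \lambda_2^{(c)} + \lambda_1^{(c)},\\ (2)\quad \lambda_3^{(a)}+\lambda_1^{(a)} &\le \lambda_2^{(b)} + \lambda_1^{(b)} + \lambda_3^{(c)} + \lambda_1^{(c)},\\ (3)\quad \lambda_2^{(a)}+\lambda_3^{(a)} &\le \lambda_2^{(b)} + \lambda_1^{(b)} + \lambda_2^{(c)} + \lambda_3^{(c)},\\ (4)\quad 2\lambda_2^{(a)}+\lambda_1^{(a)} &\le 2\lambda_2^{(b)} + \lambda_1^{(b)} + 2\lambda_2^{(c)} + \lambda_1^{(c)},\\ (5)\quad 2\lambda_1^{(a)} + \lambda_2^{(a)} &\le 2\lambda_2^{(b)} + \lambda_1^{(b)} + 2 \lambda_1^{(c)} + \lambda_2^{(c)},\\ (6)\quad 2\lambda_2^{(a)} + \lambda_3^{(a)} &\le 2 \lambda_2^{(b)} + \lambda_1^{(b)}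 + 2 \lambda_2^{(c)} + \lambda_3^{(c)},\\ (7)\quad 2\lambda_2^{(a)} + \lambda_3^{(a)} &\le 2\lambda_1^{(b)} + \lambda_2^{(b)} + 2\lambda_3^{(c)} + \lambda_2^{(c)}. \end{align*}
   Context: A three-qutrit state is a unit vector $|\Psi\rangle=\sum_{i,j,k=1}^3 c_{ijk}\,|i\rangle\otimes|j\rangle\otimes|k\rangle\in\mathbb{C}^3\otimes\mathbb{C}^3\otimes\mathbb{C}^3$, where $|1\rangle,|2\rangle,|3\rangle$ is an orthonormal basis of $\mathbb{C}^3$ and $\sum_{i,j,k}|c_{ijk}|^2=1$. Its three (one-particle) reduced density matrices are the $3\times3$ matrices $\rho^{(1)}_{ii'}=\sum_{J,K}c_{iJK}\overline{c_{i'JK}}$, $\rho^{(2)}_{jj'}=\sum_{I,K}c_{IjK}\overline{c_{Ij'K}}$, $\rho^{(3)}_{kk'}=\sum_{I,J}c_{IJk}\overline{c_{IJk'}}$. *)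

theory Defs
  imports
    "Jordan_Normal_Form.Char_Poly"
    "HOL-Computational_Algebra.Computational_Algebra"
begin

(* A vector of C^3 (x) C^3 (x) C^3 is given by its 27 coordinates c i j k in the product basis.
   Matrices are indexed from 0, so i, j, k range over 0, 1, 2 here; values of c at other
   arguments are irrelevant. *)

definition three_qutrit_state :: "(nat \<Rightarrow> nat \<Rightarrow> nat \<Rightarrow> complex) \<Rightarrow> bool" where
  "three_qutrit_state c \<longleftrightarrow> (\<Sum>i<3. \<Sum>j<3. \<Sum>k<3. (cmod (c i j k))\<^sup>2) = 1"

(* Only the particle labels a = 1, 2, 3 are meaningful. *)

definition reduced_density :: "nat \<Rightarrow> (nat \<Rightarrow> nat \<Rightarrow> nat \<Rightarrow> complex) \<Rightarrow> complex mat" where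
  "reduced_density a c =
     (if a = 1 then mat 3 3 (\<lambda>(i, i'). \<Sum>J<3. \<Sum>K<3. c i J K * cnj (c i' J K))
      else if a = 2 then mat 3 3 (\<lambda>(j, j'). \<Sum>I<3. \<Sum>K<3. c I j K * cnj (c I j' K))
      else mat 3 3 (\<lambda>(k, k'). \<Sum>I<3. \<Sum>J<3. c I J k * cnj (c I J k')))"

definition eigenvalues_mset :: "complex mat \<Rightarrow> complex multiset" where
  "eigenvalues_mset A = proots (char_poly A)"

end

theory Submission
  imports Defs "HOL-Analysis.Analysis" "Jordan_Normal_Form.Schur_Decomposition"
begin

text \<open>
  Sufficiency. Let \<open>f \<ge> 0\<close> be a continuous function of the tensor that is invariant under adding
  multiples of later slices to earlier ones (in each of the three directions) and that is multiplied by
  \<open>c powr \<lambda>\<close> when a slice is multiplied by \<open>c > 0\<close>, where the exponents \<open>\<lambda>\<close> are the prescribed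
  spectra. A maximiser \<open>y\<close> of \<open>f\<close> on the unit sphere has least norm, up to the factor
  \<open>c powr \<lambda>\<close>, among its images under these operations; to first order this says that its marginals
  are diagonal with the entries \<open>\<lambda>\<close>. Such functions arise as products of powers of moduli of covariant
  polynomials, so the exponents that occur form a convex cone. The polytope cut out by the
  inequalities has 33 vertices, 11 up to permutations of the particles, and each of them is the
  exponent of an explicit polynomial.

  Necessity. If the marginals are diagonal and \<open>u, v, w\<close> are orthonormal bases such that the
  coefficient of the tensor at \<open>u i, v j, w k\<close> vanishes whenever \<open>f i > g j + h k\<close>, then
  \<open>\<Sum> f i \<langle>u i, \<rho>1 (u i)\<rangle> \<le> \<Sum> g j \<langle>v j, \<rho>2 (v j)\<rangle> + \<Sum> h k \<langle>w k, \<rho>3 (w k)\<rangle>\<close>. Each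
  inequality follows from a choice of bases adapted to the eigenvectors.
\<close>

section \<open>Triangular operations on tensors\<close>

type_synonym tensor = "3 \<Rightarrow> 3 \<Rightarrow> 3 \<Rightarrow> complex"

definition vec3 :: "'a \<Rightarrow> 'a \<Rightarrow> 'a \<Rightarrow> 3 \<Rightarrow> 'a" where
  "vec3 a b c i = (if i = 1 then a else if i = 2 then b else c)"

lemma vec3_simps [simp]: "vec3 a b c 1 = a" "vec3 a b c 2 = b" "vec3 a b c 3 = c"
  by (simp_all add: vec3_def)

text \<open>For \<open>(m, n)\<close> equal to \<open>(1, 2)\<close> and \<open>(2, 3)\<close> these
  additions, with the scalings by nonzero factors, generate the invertible upper triangular matrices
  acting on one index.\<close>

definition add_index :: "3 \<Rightarrow> 3 \<Rightarrow> complex \<Rightarrow> (3 \<Rightarrow> complex) \<Rightarrow> 3 \<Rightarrow> complex" where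
  "add_index m n z x k = (if k = m then x k + z * x n else x k)"

definition scale_index :: "3 \<Rightarrow> complex \<Rightarrow> (3 \<Rightarrow> complex) \<Rightarrow> 3 \<Rightarrow> complex" where
  "scale_index m c x k = (if k = m then c * x k else x k)"

definition add1 :: "3 \<Rightarrow> 3 \<Rightarrow> complex \<Rightarrow> tensor \<Rightarrow> tensor" where
  "add1 m n z t i j k = add_index m n z (\<lambda>i. t i j k) i"

definition add2 :: "3 \<Rightarrow> 3 \<Rightarrow> complex \<Rightarrow> tensor \<Rightarrow> tensor" where
  "add2 m n z t i j k = add_index m n z (\<lambda>j. t i j k) j"

definition add3 :: "3 \<Rightarrow> 3 \<Rightarrow> complex \<Rightarrow> tensor \<Rightarrow> tensor" where
  "add3 m n z t i j k = add_index m n z (\<lambda>k. t i j k) k"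

definition scale1 :: "3 \<Rightarrow> complex \<Rightarrow> tensor \<Rightarrow> tensor" where
  "scale1 m c t i j k = scale_index m c (\<lambda>i. t i j k) i"

definition scale2 :: "3 \<Rightarrow> complex \<Rightarrow> tensor \<Rightarrow> tensor" where
  "scale2 m c t i j k = scale_index m c (\<lambda>j. t i j k) j"

definition scale3 :: "3 \<Rightarrow> complex \<Rightarrow> tensor \<Rightarrow> tensor" where
  "scale3 m c t i j k = scale_index m c (\<lambda>k. t i j k) k"

lemmas op_defs = add1_def add2_def add3_def scale1_def scale2_def scale3_def

section \<open>Covariant polynomials\<close>

text \<open>In terms of the vectors \<open>t i j\<close> the operations in the first two directions
  combine whole vectors, so the linearity rules of \<open>det3\<close> apply; those in the third act
  on all vectors alike.\<close>

lemma op_fibre: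
  "add1 m n z t i j = (if i = m then (\<lambda>k. t i j k + z * t n j k) else t i j)"
  "add2 m n z t i j = (if j = m then (\<lambda>k. t i j k + z * t i n k) else t i j)"
  "add3 m n z t i j = add_index m n z (t i j)"
  "scale1 m c t i j = (if i = m then (\<lambda>k. c * t i j k) else t i j)"
  "scale2 m c t i j = (if j = m then (\<lambda>k. c * t i j k) else t i j)"
  "scale3 m c t i j = scale_index m c (t i j)"
  by (auto simp: op_defs add_index_def scale_index_def fun_eq_iff)

text \<open>
  The index pair \<open>(1, 3)\<close> is omitted because that operation is a commutator of the other two,
  see \<open>add1_commutator\<close>.
\<close>

definition covariant :: "(tensor \<Rightarrow> complex) \<Rightarrow> (3 \<Rightarrow> nat) \<Rightarrow> (3 \<Rightarrow> nat) \<Rightarrow> (3 \<Rightarrow> nat) \<Rightarrow> bool" where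
  "covariant P p q r \<longleftrightarrow>
     (\<forall>(m, n)\<in>{(1, 2), (2, 3)}. \<forall>z t. P (add1 m n z t) = P t \<and> P (add2 m n z t) = P t \<and> P (add3 m n z t) = P t) \<and>
     (\<forall>m c t. P (scale1 m c t) = c ^ p m * P t \<and> P (scale2 m c t) = c ^ q m * P t \<and> P (scale3 m c t) = c ^ r m * P t)"

section \<open>Determinants of three vectors\<close>

definition det3 :: "(3 \<Rightarrow> complex) \<Rightarrow> (3 \<Rightarrow> complex) \<Rightarrow> (3 \<Rightarrow> complex) \<Rightarrow> complex" where
  "det3 x y z = x 1 * (y 2 * z 3 - y 3 * z 2) - x 2 * (y 1 * z 3 - y 3 * z 1) + x 3 * (y 1 * z 2 - y 2 * z 1)"

lemma det3_linear [simp]: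
  "det3 (\<lambda>k. x k + a * x' k) y z = det3 x y z + a * det3 x' y z"
  "det3 x (\<lambda>k. y k + a * y' k) z = det3 x y z + a * det3 x y' z"
  "det3 x y (\<lambda>k. z k + a * z' k) = det3 x y z + a * det3 x y z'"
  "det3 (\<lambda>k. a * x k) y z = a * det3 x y z"
  "det3 x (\<lambda>k. a * y k) z = a * det3 x y z"
  "det3 x y (\<lambda>k. a * z k) = a * det3 x y z"
  by (simp_all add: det3_def algebra_simps)

lemma det3_alternating [simp]: "det3 x x y = 0" "det3 x y x = 0" "det3 y x x = 0"
  by (simp_all add: det3_def algebra_simps)

lemma det3_swap: "det3 y x z = - det3 x y z" "det3 x z y = - det3 x y z"
  by (simp_all add: det3_def algebra_simps)

lemma det3_add_index [simp]:
  assumes "m \<noteq> n"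
  shows "det3 (add_index m n a x) (add_index m n a y) (add_index m n a z) = det3 x y z"
proof -
  have "det3 (add_index m n a x) (add_index m n a y) (add_index m n a z) = det3 x y z"
    if "(m, n) \<in> {(1, 2), (1, 3), (2, 1), (2, 3), (3, 1), (3, 2)}"
    using that by (auto simp: det3_def add_index_def algebra_simps)
  then show ?thesis using exhaust_3[of m] exhaust_3[of n] assms by auto
qed

lemma det3_scale_index [simp]:
  "det3 (scale_index m c x) (scale_index m c y) (scale_index m c z) = c * det3 x y z"
  using exhaust_3[of m] by (auto simp: det3_def scale_index_def algebra_simps)

text \<open>The scaling premises keep the quantifier over \<open>m\<close> in the object logic, so
  that \<open>forall_3\<close> can split them.\<close>

lemma covariantI:
  assumes "\<And>z t. P (add1 1 2 z t) = P t" "\<And>z t. P (add1 2 3 z t) = P t"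
    and "\<And>z t. P (add2 1 2 z t) = P t" "\<And>z t. P (add2 2 3 z t) = P t"
    and "\<And>z t. P (add3 1 2 z t) = P t" "\<And>z t. P (add3 2 3 z t) = P t"
    and "\<And>c t. \<forall>m. P (scale1 m c t) = c ^ p m * P t"
    and "\<And>c t. \<forall>m. P (scale2 m c t) = c ^ q m * P t"
    and "\<And>c t. \<forall>m. P (scale3 m c t) = c ^ r m * P t"
  shows "covariant P p q r"
  using assms by (simp add: covariant_def)

section \<open>Explicit covariants\<close>

definition corner_entry :: "tensor \<Rightarrow> complex" where "corner_entry t = t 3 3 3"
lemma covariant_corner_entry: "covariant corner_entry (vec3 0 0 1) (vec3 0 0 1) (vec3 0 0 1)"
  by (rule covariantI) (simp_all add: corner_entry_def forall_3 op_fibre add_index_def scale_index_def)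

definition corner_minor :: "tensor \<Rightarrow> complex" where "corner_minor t = t 3 2 2 * t 3 3 3 - t 3 2 3 * t 3 3 2"
lemma covariant_corner_minor: "covariant corner_minor (vec3 0 0 2) (vec3 0 1 1) (vec3 0 1 1)"
  by (rule covariantI) (simp_all add: corner_minor_def forall_3 op_fibre add_index_def scale_index_def algebra_simps power2_eq_square)

definition slice_det :: "tensor \<Rightarrow> complex" where "slice_det t = det3 (t 3 1) (t 3 2) (t 3 3)"
lemma covariant_slice_det: "covariant slice_det (vec3 0 0 3) (vec3 1 1 1) (vec3 1 1 1)"
  by (rule covariantI) (simp_all add: slice_det_def forall_3 op_fibre power3_eq_cube)

text \<open>Cayley's hyperdeterminant of the block with all indices in {2, 3}, written as the
  discriminant of the binary quadratic form given by the determinant of \<open>x t 3 + y t 2\<close>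
  on that block.\<close>

definition hyperdet :: "tensor \<Rightarrow> complex" where
  "hyperdet t = (t 2 2 2 * t 3 3 3 + t 2 3 3 * t 3 2 2 - t 2 2 3 * t 3 3 2 - t 2 3 2 * t 3 2 3)\<^sup>2
   - 4 * (t 2 2 2 * t 2 3 3 - t 2 2 3 * t 2 3 2) * (t 3 2 2 * t 3 3 3 - t 3 2 3 * t 3 3 2)"
lemma covariant_hyperdet: "covariant hyperdet (vec3 0 2 2) (vec3 0 2 2) (vec3 0 2 2)"
  by (rule covariantI) (simp_all add: hyperdet_def forall_3 op_fibre add_index_def scale_index_def algebra_simps power2_eq_square)

text \<open>With \<open>L x = det3 (t 3 2) (t 3 3) x\<close>, this is the two by two determinant
  with rows \<open>L (t 2 2), L (t 2 3)\<close> and \<open>t 3 2 3, t 3 3 3\<close>.\<close>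

definition bracket4 :: "tensor \<Rightarrow> complex" where
  "bracket4 t = det3 (t 3 2) (t 3 3) (t 2 2) * t 3 3 3 - det3 (t 3 2) (t 3 3) (t 2 3) * t 3 2 3"
lemma covariant_bracket4: "covariant bracket4 (vec3 0 1 3) (vec3 0 2 2) (vec3 1 1 2)"
  by (rule covariantI)
    (simp_all add: bracket4_def forall_3 op_fibre, simp_all add: add_index_def scale_index_def algebra_simps power2_eq_square power3_eq_cube)

definition bracket3 :: "tensor \<Rightarrow> complex" where "bracket3 t = det3 (t 3 3) (t 3 2) (t 2 3)"
lemma covariant_bracket3: "covariant bracket3 (vec3 0 1 2) (vec3 0 1 2) (vec3 1 1 1)"
  by (rule covariantI) (simp_all add: bracket3_def forall_3 op_fibre power2_eq_square)

text \<open>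
  The four vectors \<open>t i j\<close> with \<open>i, j \<in> {2, 3}\<close> in three-dimensional space satisfy one linear relation;
  \<open>bracket6\<close> is the determinant of the two by two array of its coefficients.
\<close>

definition bracket6 :: "tensor \<Rightarrow> complex" where
  "bracket6 t = det3 (t 2 2) (t 2 3) (t 3 3) * det3 (t 2 2) (t 3 2) (t 3 3)
        - det3 (t 2 2) (t 2 3) (t 3 2) * det3 (t 2 3) (t 3 2) (t 3 3)"
lemma covariant_bracket6: "covariant bracket6 (vec3 0 3 3) (vec3 0 3 3) (vec3 2 2 2)"
  by (rule covariantI; simp add: bracket6_def forall_3 op_fibre det3_swap(1)[of "t 2 3" "t 3 2" for t]
      det3_swap(2)[of "t 2 2" "t 3 2" "t 3 3" for t] algebra_simps power2_eq_square power3_eq_cube)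

text \<open>
  With \<open>L x = det3 (t 3 3) (t 2 3) x\<close> this is the two by two determinant of the numbers \<open>L (t i j)\<close>,
  \<open>i \<in> {2, 3}\<close>, \<open>j \<in> {1, 2}\<close>.
\<close>

definition bracket6_alt :: "tensor \<Rightarrow> complex" where
  "bracket6_alt t = det3 (t 3 3) (t 2 3) (t 3 1) * det3 (t 3 3) (t 2 3) (t 2 2)
     - det3 (t 3 3) (t 2 3) (t 3 2) * det3 (t 3 3) (t 2 3) (t 2 1)"
lemma covariant_bracket6_alt: "covariant bracket6_alt (vec3 0 3 3) (vec3 1 1 4) (vec3 2 2 2)"
  by (rule covariantI; simp add: bracket6_alt_def forall_3 op_fibre algebra_simps power2_eq_square power3_eq_cube power4_eq_xxxx)

text \<open>
  \<open>pencil_det\<close> is the binary cubic \<open>det (x t 3 + y t 2)\<close> evaluated at the root of the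
  linear form given by the last entry of \<open>x t 3 + y t 2\<close>.
\<close>

definition pencil :: "tensor \<Rightarrow> 3 \<Rightarrow> 3 \<Rightarrow> complex" where
  "pencil t j k = t 2 3 3 * t 3 j k - t 3 3 3 * t 2 j k"
definition pencil_det :: "tensor \<Rightarrow> complex" where
  "pencil_det t = det3 (pencil t 1) (pencil t 2) (pencil t 3)"
text \<open>Adding a multiple of slice 3 to slice 2 changes the two products in
  \<open>pencil\<close> by the same amount. The condition \<open>m \<noteq> 3\<close> keeps the
  coefficients \<open>t 2 3 3\<close> and \<open>t 3 3 3\<close> unchanged.\<close>

lemma pencil_op: "pencil (add1 2 3 z t) = pencil t"
  "pencil (add1 1 2 z t) = pencil t"
  "m \<noteq> 3 \<Longrightarrow> pencil (add2 m n z t) j = (if j = m then (\<lambda>k. pencil t j k + z * pencil t n k) else pencil t j)"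
  "m \<noteq> 3 \<Longrightarrow> pencil (add3 m n z t) j = add_index m n z (pencil t j)"
  "pencil (scale1 m c t) j = (if m = 1 then pencil t j else (\<lambda>k. c * pencil t j k))"
  "pencil (scale2 m c t) j = (\<lambda>k. (if m = 3 then c else 1) * scale_index m c (\<lambda>j. pencil t j k) j)"
  "pencil (scale3 m c t) j = (\<lambda>k. (if m = 3 then c else 1) * scale_index m c (pencil t j) k)"
  using exhaust_3[of m] by (auto simp: pencil_def fun_eq_iff op_defs add_index_def scale_index_def algebra_simps)
lemma covariant_pencil_det: "covariant pencil_det (vec3 0 3 3) (vec3 1 1 4) (vec3 1 1 4)"
  by (rule covariantI; simp add: pencil_det_def forall_3 pencil_op power3_eq_cube power4_eq_xxxx; simp add: scale_index_def)

text \<open>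
  Since \<open>polar3 M M M\<close> is six times the determinant of \<open>M\<close>, the values of \<open>polar3\<close> on slices are, up to
  multinomial factors, the coefficients of the determinant of a linear combination of the slices.
\<close>

definition polar3 :: "(3 \<Rightarrow> 3 \<Rightarrow> complex) \<Rightarrow> (3 \<Rightarrow> 3 \<Rightarrow> complex) \<Rightarrow> (3 \<Rightarrow> 3 \<Rightarrow> complex) \<Rightarrow> complex" where
  "polar3 M N Q = det3 (M 1) (N 2) (Q 3) + det3 (M 1) (Q 2) (N 3) + det3 (N 1) (M 2) (Q 3)
     + det3 (N 1) (Q 2) (M 3) + det3 (Q 1) (M 2) (N 3) + det3 (Q 1) (N 2) (M 3)"

lemma polar3_linear [simp]:
  "polar3 (\<lambda>j k. M j k + a * M' j k) N Q = polar3 M N Q + a * polar3 M' N Q"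
  "polar3 N (\<lambda>j k. M j k + a * M' j k) Q = polar3 N M Q + a * polar3 N M' Q"
  "polar3 N Q (\<lambda>j k. M j k + a * M' j k) = polar3 N Q M + a * polar3 N Q M'"
  "polar3 (\<lambda>j k. a * M j k) N Q = a * polar3 M N Q"
  "polar3 N (\<lambda>j k. a * M j k) Q = a * polar3 N M Q"
  "polar3 N Q (\<lambda>j k. a * M j k) = a * polar3 N Q M"
  by (simp_all add: polar3_def algebra_simps)

lemma op_slice:
  "add1 m n z t i = (if i = m then (\<lambda>j k. t i j k + z * t n j k) else t i)"
  "scale1 m c t i = (if i = m then (\<lambda>j k. c * t i j k) else t i)"
  by (auto simp: op_defs add_index_def scale_index_def fun_eq_iff)

text \<open>Row and column operations preserve determinants, hence also their polarization. In the
  expansion the extra terms cancel in pairs once the arguments of \<open>det3\<close> are sorted,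
  which is what the instances of \<open>det3_swap\<close> do.\<close>

lemma polar3_op [simp]:
  "polar3 (add2 1 2 z t h) (add2 1 2 z t i) (add2 1 2 z t j) = polar3 (t h) (t i) (t j)"
  "polar3 (add2 2 3 z t h) (add2 2 3 z t i) (add2 2 3 z t j) = polar3 (t h) (t i) (t j)"
  "polar3 (add3 1 2 z t h) (add3 1 2 z t i) (add3 1 2 z t j) = polar3 (t h) (t i) (t j)"
  "polar3 (add3 2 3 z t h) (add3 2 3 z t i) (add3 2 3 z t j) = polar3 (t h) (t i) (t j)"
  "polar3 (scale3 m c t h) (scale3 m c t i) (scale3 m c t j) = c * polar3 (t h) (t i) (t j)"
  by (simp_all add: polar3_def op_fibre algebra_simps det3_swap(1)[of "t h 2" "t i 2"] det3_swap(1)[of "t h 2" "t j 2"]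
     det3_swap(1)[of "t i 2" "t j 2"] det3_swap(2)[of _ "t h 3" "t i 3"] det3_swap(2)[of _ "t h 3" "t j 3"]
     det3_swap(2)[of _ "t i 3" "t j 3"])

lemma polar3_scale2 [simp]:
  "polar3 (scale2 m c t h) (scale2 m c t i) (scale2 m c t j) = c * polar3 (t h) (t i) (t j)"
  using exhaust_3[of m] by (auto simp: polar3_def op_fibre algebra_simps)

text \<open>
  Discriminant, up to sign and scale, of \<open>a x^3 + 3 b x^2 y + 3 c x y^2 + d y^3\<close>.
\<close>

definition cubic_disc :: "complex \<Rightarrow> complex \<Rightarrow> complex \<Rightarrow> complex \<Rightarrow> complex" where
  "cubic_disc a b c d = a\<^sup>2 * d\<^sup>2 - 6 * a * b * c * d + 4 * a * c^3 + 4 * b^3 * d - 3 * b\<^sup>2 * c\<^sup>2"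

text \<open>The symmetry of \<open>polar3\<close>, stated for specific slices so that rewriting
  sorts the indices and terminates.\<close>

lemma polar3_sort:
  "polar3 (t 2) (t 1) Q = polar3 (t 1) (t 2) Q" "polar3 M (t 2) (t 1) = polar3 M (t 1) (t 2)"
  "polar3 (t 3) (t 1) Q = polar3 (t 1) (t 3) Q" "polar3 M (t 3) (t 1) = polar3 M (t 1) (t 3)"
  "polar3 (t 3) (t 2) Q = polar3 (t 2) (t 3) Q" "polar3 M (t 3) (t 2) = polar3 M (t 2) (t 3)"
  by (simp_all add: polar3_def)

text \<open>Up to a constant factor, the discriminant of the binary cubic
  \<open>det (x t 3 + y t 2)\<close>.\<close>

definition pencil_disc :: "tensor \<Rightarrow> complex" where
  "pencil_disc t = cubic_disc (polar3 (t 3) (t 3) (t 3)) (polar3 (t 2) (t 3) (t 3)) (polar3 (t 2) (t 2) (t 3)) (polar3 (t 2) (t 2) (t 2))"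

lemma cubic_disc_scale: "cubic_disc (c * p) (c * q) (c * r) (c * s) = c^4 * cubic_disc p q r s"
  by (simp add: cubic_disc_def algebra_simps power2_eq_square power3_eq_cube power4_eq_xxxx)

lemma covariant_pencil_disc: "covariant pencil_disc (vec3 0 6 6) (vec3 4 4 4) (vec3 4 4 4)"
  by (rule covariantI; simp add: pencil_disc_def forall_3 op_slice cubic_disc_scale polar3_sort;
    simp add: cubic_disc_def algebra_simps power2_eq_square eval_nat_numeral)

text \<open>
  Salmon's formula for the Aronhold invariant of the ternary cubic
  \<open>a x^3 + b y^3 + c z^3 + 3 a2 x^2 y + 3 a3 x^2 z + 3 b1 x y^2 + 3 b3 y^2 z + 3 c1 x z^2 + 3 c2 y z^2 + 6 m x y z\<close>.
\<close>

definition aronhold :: "complex \<Rightarrow> complex \<Rightarrow> complex \<Rightarrow> complex \<Rightarrow> complex \<Rightarrow> complex \<Rightarrow> complex \<Rightarrow> complex \<Rightarrow> complex \<Rightarrow> complex \<Rightarrow> complex" where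
  "aronhold a b c a2 a3 b1 b3 c1 c2 m = a * b * c * m - (b * c * a2 * a3 + c * a * b1 * b3 + a * b * c1 * c2)
    - m * (a * b3 * c2 + b * c1 * a3 + c * a2 * b1)
    + (a * b1 * c2\<^sup>2 + a * c1 * b3\<^sup>2 + b * a2 * c1\<^sup>2 + b * c2 * a3\<^sup>2 + c * b3 * a2\<^sup>2 + c * a3 * b1\<^sup>2)
    - m^4 + 2 * m\<^sup>2 * (b1 * c1 + c2 * a2 + a3 * b3) - 3 * m * (a2 * b3 * c1 + a3 * b1 * c2)
    - (b1\<^sup>2 * c1\<^sup>2 + c2\<^sup>2 * a2\<^sup>2 + a3\<^sup>2 * b3\<^sup>2) + (c2 * a2 * a3 * b3 + a3 * b3 * b1 * c1 + b1 * c1 * c2 * a2)"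

lemma aronhold_scale: "aronhold (x*a) (x*b) (x*c) (x*a2) (x*a3) (x*b1) (x*b3) (x*c1) (x*c2) (x*m) = x^4 * aronhold a b c a2 a3 b1 b3 c1 c2 m"
  by (simp add: aronhold_def algebra_simps power2_eq_square power4_eq_xxxx)

text \<open>Up to a constant factor, the Aronhold invariant of the ternary cubic
  \<open>det (x t 1 + y t 2 + z t 3)\<close>.\<close>

definition slice_aronhold :: "tensor \<Rightarrow> complex" where
  "slice_aronhold t = aronhold (polar3 (t 1) (t 1) (t 1)) (polar3 (t 2) (t 2) (t 2)) (polar3 (t 3) (t 3) (t 3))
    (polar3 (t 1) (t 1) (t 2)) (polar3 (t 1) (t 1) (t 3)) (polar3 (t 1) (t 2) (t 2))
    (polar3 (t 2) (t 2) (t 3)) (polar3 (t 1) (t 3) (t 3)) (polar3 (t 2) (t 3) (t 3)) (polar3 (t 1) (t 2) (t 3))"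

lemma covariant_slice_aronhold: "covariant slice_aronhold (vec3 4 4 4) (vec3 4 4 4) (vec3 4 4 4)"
  by (rule covariantI; simp add: slice_aronhold_def forall_3 op_slice aronhold_scale polar3_sort;
    simp add: aronhold_def algebra_simps power2_eq_square eval_nat_numeral)

section \<open>Extremal tensors have diagonal marginals\<close>

definition sq_norm :: "tensor \<Rightarrow> real" where
  "sq_norm t = (\<Sum>i\<in>UNIV. \<Sum>j\<in>UNIV. \<Sum>k\<in>UNIV. (cmod (t i j k))\<^sup>2)"

definition marginal1 :: "tensor \<Rightarrow> 3 \<Rightarrow> 3 \<Rightarrow> complex" where
  "marginal1 t i i' = (\<Sum>j\<in>UNIV. \<Sum>k\<in>UNIV. t i j k * cnj (t i' j k))"

definition swap12 :: "tensor \<Rightarrow> tensor" where "swap12 t i j k = t j i k"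
definition swap13 :: "tensor \<Rightarrow> tensor" where "swap13 t i j k = t k j i"

definition diag_marginals :: "tensor \<Rightarrow> (3 \<Rightarrow> real) \<Rightarrow> (3 \<Rightarrow> real) \<Rightarrow> (3 \<Rightarrow> real) \<Rightarrow> bool" where
  "diag_marginals t p q r \<longleftrightarrow>
     (\<forall>i i'. marginal1 t i i' = (if i = i' then of_real (p i) else 0)) \<and>
     (\<forall>i i'. marginal1 (swap12 t) i i' = (if i = i' then of_real (q i) else 0)) \<and>
     (\<forall>i i'. marginal1 (swap13 t) i i' = (if i = i' then of_real (r i) else 0))"

text \<open>For \<open>z\<close> a small negative multiple of \<open>cnj a\<close> the linear term
  would dominate and make the expression negative.\<close>

lemma linear_term_zero:
  fixes a :: complex and b :: real
  assumes "\<And>z. 0 \<le> 2 * Re (z * a) + (cmod z)\<^sup>2 * b"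
  shows "a = 0"
proof (rule ccontr)
  assume "a \<noteq> 0"
  define e where "e = 1 / (\<bar>b\<bar> + 1)"
  have e: "e > 0" "e * b < 1"
    by (auto simp: e_def field_simps)
  have "0 \<le> 2 * Re (- of_real e * cnj a * a) + (cmod (- of_real e * cnj a))\<^sup>2 * b"
    by (rule assms)
  also have "\<dots> = - 2 * e * (cmod a)\<^sup>2 + (cmod (- of_real e * cnj a))\<^sup>2 * b"
    unfolding cmod_power2[of a] by (simp add: power2_eq_square algebra_simps)
  also have "\<dots> = - 2 * e * (cmod a)\<^sup>2 + (e * cmod a)\<^sup>2 * b"
    using e(1) by (simp add: norm_mult)
  also have "\<dots> = e * (cmod a)\<^sup>2 * (e * b - 2)"
    by (simp add: power2_eq_square algebra_simps)
  finally have "0 \<le> e * (cmod a)\<^sup>2 * (e * b - 2)" .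
  moreover have "e * (cmod a)\<^sup>2 > 0" using e \<open>a \<noteq> 0\<close> by simp
  ultimately show False using e(2) by (simp add: zero_le_mult_iff)
qed

text \<open>The difference of the two sides has a minimum at \<open>s = 1\<close>, where both equal
  1, so its derivative vanishes there.\<close>

lemma tangent_slope:
  fixes a p :: real
  assumes "\<And>s. s > 0 \<Longrightarrow> s powr p \<le> 1 + (s - 1) * a"
  shows "a = p"
proof -
  let ?g = "\<lambda>s::real. 1 + (s - 1) * a - s powr p"
  have deriv: "(?g has_real_derivative a - p) (at 1)"
    by (auto intro!: derivative_eq_intros)
  have min: "\<forall>s. \<bar>1 - s\<bar> < 1 \<longrightarrow> ?g 1 \<le> ?g s"
    using assms by auto
  have "a - p = 0"
    by (rule DERIV_local_min[OF deriv _ min]) simp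
  then show ?thesis by simp
qed

lemma sq_norm_fibres: "sq_norm t = (\<Sum>i\<in>UNIV. Re (marginal1 t i i))"
  by (simp add: sq_norm_def marginal1_def complex_mult_cnj cmod_power2)

lemma marginal1_add1:
  assumes "m \<noteq> n"
  shows "Re (marginal1 (add1 m n z t) m m) =
    Re (marginal1 t m m) + (2 * Re (z * marginal1 t n m) + (cmod z)\<^sup>2 * Re (marginal1 t n n))"
proof -
  have *: "Re ((x + z * y) * cnj (x + z * y)) = Re (x * cnj x) + (Re (2 * z * (y * cnj x)) + (cmod z)\<^sup>2 * Re (y * cnj y))"
    for x y :: complex
    unfolding cmod_power2 by (simp add: power2_eq_square algebra_simps)
  have "Re (marginal1 (add1 m n z t) m m) =
    (\<Sum>j\<in>UNIV. \<Sum>k\<in>UNIV. Re ((t m j k + z * t n j k) * cnj (t m j k + z * t n j k)))"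
    unfolding marginal1_def add1_def add_index_def if_True simp_thms Re_sum ..
  also have "\<dots> = Re (marginal1 t m m) + (Re (2 * z * marginal1 t n m) + (cmod z)\<^sup>2 * Re (marginal1 t n n))"
    unfolding * marginal1_def sum.distrib sum_distrib_left Re_sum ..
  finally show ?thesis by (simp add: mult.assoc)
qed

lemma sq_norm_add1:
  assumes "m \<noteq> n"
  shows "sq_norm (add1 m n z t) = sq_norm t + (2 * Re (z * marginal1 t n m) + (cmod z)\<^sup>2 * Re (marginal1 t n n))"
proof -
  have "marginal1 (add1 m n z t) i i = marginal1 t i i" if "i \<noteq> m" for i
    using that by (simp add: marginal1_def add1_def add_index_def)
  then have "Re (marginal1 (add1 m n z t) i i) = Re (marginal1 t i i) +
     (if i = m then 2 * Re (z * marginal1 t n m) + (cmod z)\<^sup>2 * Re (marginal1 t n n) else 0)" for i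
    using marginal1_add1[OF assms, of z t] by auto
  then show ?thesis by (simp add: sq_norm_fibres sum.distrib)
qed

lemma sq_norm_scale1:
  "sq_norm (scale1 m (of_real c) t) = sq_norm t + (c\<^sup>2 - 1) * Re (marginal1 t m m)"
proof -
  have "marginal1 (scale1 m (of_real c) t) m m = (of_real c)\<^sup>2 * marginal1 t m m"
    by (simp add: marginal1_def scale1_def scale_index_def sum_distrib_left power2_eq_square mult_ac)
  moreover have "marginal1 (scale1 m (of_real c) t) i i = marginal1 t i i" if "i \<noteq> m" for i
    using that by (simp add: marginal1_def scale1_def scale_index_def)
  ultimately have "Re (marginal1 (scale1 m (of_real c) t) i i) = Re (marginal1 t i i) +
     (if i = m then (c\<^sup>2 - 1) * Re (marginal1 t m m) else 0)" for i
    by (auto simp: algebra_simps simp flip: of_real_power)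
  then show ?thesis by (simp add: sq_norm_fibres sum.distrib)
qed

lemma add1_commutator:
  "add1 1 3 z t = add1 1 2 (- 1) (add1 2 3 (- z) (add1 1 2 1 (add1 2 3 z t)))"
  by (auto simp: fun_eq_iff add1_def add_index_def)

lemma marginal1_sym: "marginal1 t i' i = cnj (marginal1 t i i')"
  by (simp add: marginal1_def algebra_simps)

lemma extremal_marginal1:
  fixes f :: "tensor \<Rightarrow> real" and p :: "3 \<Rightarrow> real"
  assumes bound: "\<And>t. f t \<le> sqrt (sq_norm t) * f y" and y: "sq_norm y = 1" "f y > 0"
    and add: "\<And>z t. f (add1 1 2 z t) = f t" "\<And>z t. f (add1 2 3 z t) = f t"
    and scale: "\<And>m c t. c > 0 \<Longrightarrow> f (scale1 m (of_real c) t) = c powr p m * f t"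
  shows "marginal1 y i i' = (if i = i' then of_real (p i) else 0)"
proof -
  have off: "marginal1 y n m = 0" if mn: "(m, n) \<in> {(1, 2), (2, 3), (1, 3)}" for m n
  proof (rule linear_term_zero)
    fix z
    have "f (add1 m n z y) = f y" using mn add by (auto simp: add1_commutator)
    with bound[of "add1 m n z y"] y have "1 \<le> sqrt (sq_norm (add1 m n z y))"
      by (simp add: mult_le_cancel_right1)
    then have "1 \<le> sq_norm (add1 m n z y)" by simp
    moreover have "m \<noteq> n" using mn by auto
    ultimately show "0 \<le> 2 * Re (z * marginal1 y n m) + (cmod z)\<^sup>2 * Re (marginal1 y n n)"
      using y sq_norm_add1[of m n z y] by simp
  qed
  have "Re (marginal1 y m m) = p m" for m
  proof (rule tangent_slope)
    fix s :: real assume s: "s > 0"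
    \<comment> \<open>Scaling by \<open>sqrt s\<close> makes the squared norm affine in
      \<open>s\<close>, as \<open>tangent_slope\<close> requires.\<close>
    have "(sqrt s) powr p m * f y \<le> sqrt (sq_norm (scale1 m (of_real (sqrt s)) y)) * f y"
      using bound[of "scale1 m (of_real (sqrt s)) y"] scale[of "sqrt s" m y] s by simp
    then have "(sqrt s) powr p m \<le> sqrt (1 + (s - 1) * Re (marginal1 y m m))"
      using y s by (simp add: sq_norm_scale1)
    moreover have "(sqrt s) powr p m = sqrt (s powr p m)"
      using s by (simp add: powr_half_sqrt[symmetric] powr_powr mult.commute)
    ultimately show "s powr p m \<le> 1 + (s - 1) * Re (marginal1 y m m)" by simp
  qed
  moreover have "Im (marginal1 y m m) = 0" for m
    by (simp add: marginal1_def)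
  ultimately have "marginal1 y m m = of_real (p m)" for m
    by (simp add: complex_eq_iff)
  moreover have "marginal1 y m n = 0" if "m \<noteq> n" for m n
  proof -
    \<comment> \<open>One of the two index pairs is in increasing order and is covered by
      \<open>off\<close>; Hermitian symmetry gives the other.\<close>
    have "marginal1 y n m = 0 \<or> marginal1 y m n = 0"
      using that exhaust_3[of m] exhaust_3[of n] off[of m n] off[of n m] by auto
    then show ?thesis using marginal1_sym[of y m n] by auto
  qed
  ultimately show ?thesis by auto
qed

lemma swap_involution [simp]: "swap12 (swap12 t) = t" "swap13 (swap13 t) = t"
  by (simp_all add: fun_eq_iff swap12_def swap13_def)

lemma swap_ops:
  "swap12 (add1 m n z t) = add2 m n z (swap12 t)" "swap12 (scale1 m c t) = scale2 m c (swap12 t)"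
  "swap13 (add1 m n z t) = add3 m n z (swap13 t)" "swap13 (scale1 m c t) = scale3 m c (swap13 t)"
  by (simp_all add: fun_eq_iff swap12_def swap13_def add1_def add2_def add3_def scale1_def scale2_def scale3_def)

lemma sq_norm_swap [simp]: "sq_norm (swap12 t) = sq_norm t" "sq_norm (swap13 t) = sq_norm t"
  unfolding sq_norm_def swap12_def swap13_def sum_3 by simp_all

text \<open>Continuity is expressed on \<open>complex ^ 3 ^ 3 ^ 3\<close>, whose Euclidean norm
  squares to \<open>sq_norm\<close> and whose unit sphere is compact.\<close>

definition weight_function :: "(tensor \<Rightarrow> real) \<Rightarrow> (3 \<Rightarrow> real) \<Rightarrow> (3 \<Rightarrow> real) \<Rightarrow> (3 \<Rightarrow> real) \<Rightarrow> bool" where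
  "weight_function f p q r \<longleftrightarrow>
     continuous_on UNIV (\<lambda>x :: complex ^ 3 ^ 3 ^ 3. f (\<lambda>i j k. vec_nth (vec_nth (vec_nth x i) j) k)) \<and>
     (\<forall>t. 0 \<le> f t) \<and>
     (\<forall>(m, n)\<in>{(1, 2), (2, 3)}. \<forall>z t. f (add1 m n z t) = f t \<and> f (add2 m n z t) = f t \<and> f (add3 m n z t) = f t) \<and>
     (\<forall>m t. \<forall>c>0. f (scale1 m (of_real c) t) = c powr p m * f t \<and>
        f (scale2 m (of_real c) t) = c powr q m * f t \<and> f (scale3 m (of_real c) t) = c powr r m * f t)"

text \<open>Since \<open>p\<close> sums to one, \<open>f\<close> is homogeneous of degree one, so a
  maximum on the compact unit sphere gives a bound for all tensors that is attained at the
  maximiser.\<close>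

lemma diag_marginals_of_weight_function:
  assumes f: "weight_function f p q r" and x: "f x > 0" and p: "p 1 + p 2 + p 3 = 1"
  shows "\<exists>t. diag_marginals t p q r"
proof -
  define tens where "tens x = (\<lambda>i j k. vec_nth (vec_nth (vec_nth x i) j) k)" for x :: "complex ^ 3 ^ 3 ^ 3"
  have surj: "\<exists>x. tens x = t" for t
    by (rule exI[of _ "\<chi> i j k. t i j k"]) (simp add: tens_def)
  have norm: "sq_norm (tens x) = (norm x)\<^sup>2" for x
    by (simp add: sq_norm_def tens_def norm_vec_def L2_set_def sum_nonneg)
  have homog: "f (\<lambda>i j k. of_real c * t i j k) = c * f t" if "c > 0" for c t
  proof -
    have "(\<lambda>i j k. of_real c * t i j k) = scale1 1 (of_real c) (scale1 2 (of_real c) (scale1 3 (of_real c) t))"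
      using exhaust_3 by (fastforce simp: fun_eq_iff scale1_def scale_index_def)
    then have "f (\<lambda>i j k. of_real c * t i j k) = c powr (p 1 + p 2 + p 3) * f t"
      using f that by (simp add: weight_function_def powr_add)
    then show ?thesis using p that by simp
  qed
  \<comment> \<open>Homogeneity gives \<open>f 0 = 2 * f 0\<close>.\<close>
  have f0: "f (\<lambda>i j k. 0) = 0" using homog[of 2 "\<lambda>i j k. 0"] by simp
  have "continuous_on (sphere 0 1) (\<lambda>x. f (tens x))"
    using f unfolding weight_function_def tens_def by (meson continuous_on_subset subset_UNIV)
  then obtain a where a: "norm a = 1" "\<And>x. norm x = 1 \<Longrightarrow> f (tens x) \<le> f (tens a)"
    using continuous_attains_sup[of "sphere (0 :: complex ^ 3 ^ 3 ^ 3) 1" "\<lambda>x. f (tens x)"] by auto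
  define y where "y = tens a"
  have bound: "f t \<le> sqrt (sq_norm t) * f y" for t
  proof -
    obtain b where b: "t = tens b" using surj by metis
    show ?thesis
    proof (cases "b = 0")
      case True
      then show ?thesis using f0 by (simp add: b tens_def sq_norm_def)
    next
      case False
      then have nb: "norm b > 0" by simp
      have "norm ((1 / norm b) *\<^sub>R b) = 1" using nb by simp
      then have "f (tens ((1 / norm b) *\<^sub>R b)) \<le> f y" unfolding y_def by (rule a(2))
      also have "tens ((1 / norm b) *\<^sub>R b) = (\<lambda>i j k. of_real (1 / norm b) * t i j k)"
        by (simp add: tens_def b fun_eq_iff scaleR_conv_of_real[where 'a = complex])
      finally have "(1 / norm b) * f t \<le> f y" using homog[of "1 / norm b" t] nb by simp
      then have "f t \<le> norm b * f y" using nb by (simp add: field_simps)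
      then show ?thesis by (simp add: b norm)
    qed
  qed
  have y: "sq_norm y = 1" using a norm by (simp add: y_def)
  have fy: "f y > 0"
  proof (rule ccontr)
    assume "\<not> f y > 0"
    then have "f y = 0" using f by (auto simp: weight_function_def order.antisym not_less)
    then show False using bound[of x] x by simp
  qed
  have 1: "marginal1 y i i' = (if i = i' then of_real (p i) else 0)" for i i'
    by (rule extremal_marginal1[where f = f]) (use bound y fy f in \<open>auto simp: weight_function_def\<close>)
  \<comment> \<open>Composition with a swap turns the second, and likewise the third, direction into
    the first.\<close>
  have 2: "marginal1 (swap12 y) i i' = (if i = i' then of_real (q i) else 0)" for i i'
    by (rule extremal_marginal1[where f = "\<lambda>t. f (swap12 t)"])
      (use bound[of "swap12 t" for t] y fy f in \<open>auto simp: weight_function_def swap_ops\<close>)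
  have 3: "marginal1 (swap13 y) i i' = (if i = i' then of_real (r i) else 0)" for i i'
    by (rule extremal_marginal1[where f = "\<lambda>t. f (swap13 t)"])
      (use bound[of "swap13 t" for t] y fy f in \<open>auto simp: weight_function_def swap_ops\<close>)
  show ?thesis using 1 2 3 unfolding diag_marginals_def by blast
qed

section \<open>The cone of weights\<close>

text \<open>
  A tensor, found by search, at which no covariant used below vanishes, even after exchanging two
  particles. It is invariant under cyclic shifts of the particles, so its orbit under permutations has only
  two elements.
\<close>

definition base_tensor :: tensor where
  "base_tensor = vec3
     (vec3 (vec3 0 0 1) (vec3 0 1 1) (vec3 1 0 0))
     (vec3 (vec3 0 1 0) (vec3 1 0 (- 1)) (vec3 1 (- 1) 0))
     (vec3 (vec3 1 1 0) (vec3 0 (- 1) 0) (vec3 0 0 1))"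

lemma base_tensor_symmetric:
  "swap12 (swap13 base_tensor) = swap13 (swap12 base_tensor)"
  "swap13 base_tensor = swap12 base_tensor"
  unfolding fun_eq_iff forall_3 by (simp_all add: swap12_def swap13_def base_tensor_def)

text \<open>Positivity at common points ensures that products do not vanish there. Taking both
  tensors of the orbit makes the notion invariant under permutations of the particles.\<close>

definition weight :: "(3 \<Rightarrow> real) \<Rightarrow> (3 \<Rightarrow> real) \<Rightarrow> (3 \<Rightarrow> real) \<Rightarrow> bool" where
  "weight p q r \<longleftrightarrow> (\<exists>f. weight_function f p q r \<and> f base_tensor > 0 \<and> f (swap12 base_tensor) > 0)"

lemma weight_zero: "weight (\<lambda>_. 0) (\<lambda>_. 0) (\<lambda>_. 0)"
  unfolding weight_def weight_function_def
  by (rule exI[of _ "\<lambda>_. 1"]) auto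

lemma weight_add:
  assumes "weight p q r" "weight p' q' r'"
  shows "weight (\<lambda>i. p i + p' i) (\<lambda>i. q i + q' i) (\<lambda>i. r i + r' i)"
proof -
  obtain f g where f: "weight_function f p q r" "f base_tensor > 0" "f (swap12 base_tensor) > 0"
    and g: "weight_function g p' q' r'" "g base_tensor > 0" "g (swap12 base_tensor) > 0"
    using assms by (auto simp: weight_def)
  have "weight_function (\<lambda>t. f t * g t) (\<lambda>i. p i + p' i) (\<lambda>i. q i + q' i) (\<lambda>i. r i + r' i)"
    using f(1) g(1) unfolding weight_function_def
    by (auto simp: powr_add intro!: continuous_intros)
  then show ?thesis unfolding weight_def using f g by (intro exI[of _ "\<lambda>t. f t * g t"]) auto
qed

lemma weight_scale:
  assumes "weight p q r" "s \<ge> 0"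
  shows "weight (\<lambda>i. s * p i) (\<lambda>i. s * q i) (\<lambda>i. s * r i)"
\<comment> \<open>At exponent 0 the power is 0 where \<open>f\<close> vanishes and 1 elsewhere, so
  continuity could fail; the constant function serves instead.\<close>
proof (cases "s = 0")
  case True
  then show ?thesis using weight_zero by simp
next
  case False
  obtain f where f: "weight_function f p q r" "f base_tensor > 0" "f (swap12 base_tensor) > 0"
    using assms by (auto simp: weight_def)
  have "weight_function (\<lambda>t. f t powr s) (\<lambda>i. s * p i) (\<lambda>i. s * q i) (\<lambda>i. s * r i)"
    using f(1) assms(2) False unfolding weight_function_def
    by (auto simp: powr_mult powr_powr mult.commute intro!: continuous_on_powr' continuous_on_const)
  then show ?thesis unfolding weight_def using f by (intro exI[of _ "\<lambda>t. f t powr s"]) auto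
qed

lemma swap12_ops:
  "swap12 (add2 m n z t) = add1 m n z (swap12 t)" "swap12 (scale2 m c t) = scale1 m c (swap12 t)"
  "swap12 (add3 m n z t) = add3 m n z (swap12 t)" "swap12 (scale3 m c t) = scale3 m c (swap12 t)"
  "swap13 (add3 m n z t) = add1 m n z (swap13 t)" "swap13 (scale3 m c t) = scale1 m c (swap13 t)"
  "swap13 (add2 m n z t) = add2 m n z (swap13 t)" "swap13 (scale2 m c t) = scale2 m c (swap13 t)"
  by (simp_all add: fun_eq_iff swap12_def swap13_def op_defs)

lemma continuous_on_swap:
  assumes "continuous_on UNIV (\<lambda>x :: complex ^ 3 ^ 3 ^ 3. f (\<lambda>i j k. vec_nth (vec_nth (vec_nth x i) j) k))"
  shows "continuous_on UNIV (\<lambda>x :: complex ^ 3 ^ 3 ^ 3. f (swap12 (\<lambda>i j k. vec_nth (vec_nth (vec_nth x i) j) k)))"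
    "continuous_on UNIV (\<lambda>x :: complex ^ 3 ^ 3 ^ 3. f (swap13 (\<lambda>i j k. vec_nth (vec_nth (vec_nth x i) j) k)))"
proof -
  have "continuous_on UNIV (\<lambda>x :: complex ^ 3 ^ 3 ^ 3. (\<chi> i j k. vec_nth (vec_nth (vec_nth x j) i) k))"
    "continuous_on UNIV (\<lambda>x :: complex ^ 3 ^ 3 ^ 3. (\<chi> i j k. vec_nth (vec_nth (vec_nth x k) j) i))"
    by (intro continuous_intros)+
  from this[THEN continuous_on_compose2[OF assms]]
  show "continuous_on UNIV (\<lambda>x :: complex ^ 3 ^ 3 ^ 3. f (swap12 (\<lambda>i j k. vec_nth (vec_nth (vec_nth x i) j) k)))"
    "continuous_on UNIV (\<lambda>x :: complex ^ 3 ^ 3 ^ 3. f (swap13 (\<lambda>i j k. vec_nth (vec_nth (vec_nth x i) j) k)))"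
    by (simp_all add: swap12_def[abs_def] swap13_def[abs_def])
qed

lemma weight_swap12: "weight p q r \<Longrightarrow> weight q p r"
  unfolding weight_def weight_function_def
  by (elim exE conjE, rule_tac x = "\<lambda>t. f (swap12 t)" in exI)
    (auto simp: swap_ops swap12_ops continuous_on_swap)

lemma weight_swap13: "weight p q r \<Longrightarrow> weight r q p"
  unfolding weight_def weight_function_def
  by (elim exE conjE, rule_tac x = "\<lambda>t. f (swap13 t)" in exI)
    (auto simp: swap_ops swap12_ops continuous_on_swap base_tensor_symmetric simp flip: base_tensor_symmetric(2))

lemma weight_of_covariant:
  assumes P: "covariant P p q r"
    and cont: "continuous_on UNIV (\<lambda>x :: complex ^ 3 ^ 3 ^ 3. P (\<lambda>i j k. vec_nth (vec_nth (vec_nth x i) j) k))"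
    and nz: "P base_tensor \<noteq> 0" "P (swap12 base_tensor) \<noteq> 0"
  shows "weight (\<lambda>i. real (p i)) (\<lambda>i. real (q i)) (\<lambda>i. real (r i))"
proof -
  have "weight_function (\<lambda>t. cmod (P t)) (\<lambda>i. real (p i)) (\<lambda>i. real (q i)) (\<lambda>i. real (r i))"
    using P cont unfolding weight_function_def covariant_def
    by (auto simp: norm_mult norm_power powr_realpow intro!: continuous_intros)
  then show ?thesis using nz unfolding weight_def by (intro exI[of _ "\<lambda>t. cmod (P t)"]) auto
qed

definition "covariants =
  {corner_entry, corner_minor, slice_det, hyperdet, bracket4, bracket3, bracket6, bracket6_alt,
   pencil_det, pencil_disc, slice_aronhold}"

lemmas poly_defs =
  corner_entry_def corner_minor_def slice_det_def hyperdet_def bracket4_def bracket3_def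
  bracket6_def bracket6_alt_def pencil_det_def pencil_def
  pencil_disc_def slice_aronhold_def cubic_disc_def aronhold_def polar3_def det3_def

lemma continuous_covariant:
  assumes "P \<in> covariants"
  shows "continuous_on UNIV (\<lambda>x :: complex ^ 3 ^ 3 ^ 3. P (\<lambda>i j k. vec_nth (vec_nth (vec_nth x i) j) k))"
  using assms unfolding covariants_def by (elim insertE emptyE; simp add: poly_defs; intro continuous_intros)

lemma covariant_nonvanishing:
  assumes "P \<in> covariants"
  shows "P base_tensor \<noteq> 0" "P (swap12 base_tensor) \<noteq> 0"
  using assms unfolding covariants_def by (elim insertE emptyE; simp add: poly_defs base_tensor_def swap12_def)+

text \<open>In each triple the common sum of the entries is the degree of the polynomial; dividing
  by it gives a vertex with spectra of sum one.\<close>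

lemma weight_generators:
  "weight (vec3 0 0 1) (vec3 0 0 1) (vec3 0 0 1)"
  "weight (vec3 0 0 2) (vec3 0 1 1) (vec3 0 1 1)"
  "weight (vec3 0 0 3) (vec3 1 1 1) (vec3 1 1 1)"
  "weight (vec3 0 2 2) (vec3 0 2 2) (vec3 0 2 2)"
  "weight (vec3 0 1 3) (vec3 0 2 2) (vec3 1 1 2)"
  "weight (vec3 0 1 2) (vec3 0 1 2) (vec3 1 1 1)"
  "weight (vec3 0 3 3) (vec3 0 3 3) (vec3 2 2 2)"
  "weight (vec3 0 3 3) (vec3 1 1 4) (vec3 2 2 2)"
  "weight (vec3 0 3 3) (vec3 1 1 4) (vec3 1 1 4)"
  "weight (vec3 0 6 6) (vec3 4 4 4) (vec3 4 4 4)"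
  "weight (vec3 4 4 4) (vec3 4 4 4) (vec3 4 4 4)"
proof -
  have real_vec3: "(\<lambda>i. real (vec3 a b c i)) = vec3 (real a) (real b) (real c)" for a b c
    by (auto simp: vec3_def)
  have *: "weight (vec3 (real p1) (real p2) (real p3)) (vec3 (real q1) (real q2) (real q3)) (vec3 (real r1) (real r2) (real r3))"
    if "covariant P (vec3 p1 p2 p3) (vec3 q1 q2 q3) (vec3 r1 r2 r3)"
      "P \<in> covariants"
    for P p1 p2 p3 q1 q2 q3 r1 r2 r3
    using weight_of_covariant[OF that(1) continuous_covariant[OF that(2)] covariant_nonvanishing[OF that(2)]]
    unfolding real_vec3 .
  note gen = covariant_corner_entry covariant_corner_minor covariant_slice_det covariant_hyperdet covariant_bracket4
    covariant_bracket3 covariant_bracket6 covariant_bracket6_alt covariant_pencil_det covariant_pencil_disc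
    covariant_slice_aronhold
  show "weight (vec3 0 0 1) (vec3 0 0 1) (vec3 0 0 1)"
    "weight (vec3 0 0 2) (vec3 0 1 1) (vec3 0 1 1)"
    "weight (vec3 0 0 3) (vec3 1 1 1) (vec3 1 1 1)"
    "weight (vec3 0 2 2) (vec3 0 2 2) (vec3 0 2 2)"
    "weight (vec3 0 1 3) (vec3 0 2 2) (vec3 1 1 2)"
    "weight (vec3 0 1 2) (vec3 0 1 2) (vec3 1 1 1)"
    "weight (vec3 0 3 3) (vec3 0 3 3) (vec3 2 2 2)"
    "weight (vec3 0 3 3) (vec3 1 1 4) (vec3 2 2 2)"
    "weight (vec3 0 3 3) (vec3 1 1 4) (vec3 1 1 4)"
    "weight (vec3 0 6 6) (vec3 4 4 4) (vec3 4 4 4)"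
    "weight (vec3 4 4 4) (vec3 4 4 4) (vec3 4 4 4)"
    using gen[THEN *] by (simp_all add: covariants_def)
qed

section \<open>The polytope lies in the cone of weights\<close>

lemma weight_perms:
  assumes "weight p q r"
  shows "weight p r q" "weight q p r" "weight q r p" "weight r p q" "weight r q p"
  using assms weight_swap13[OF weight_swap12[OF weight_swap13[OF assms]]] weight_swap12[OF weight_swap13[OF assms]]
    weight_swap13[OF weight_swap12[OF assms]] weight_swap12[OF assms] weight_swap13[OF assms] by blast+

lemma weight_combine:
  assumes "weight v v' v''" "0 \<le> s" "weight y y' y''"
    and "\<And>i. p i = s * v i + y i" "\<And>i. q i = s * v' i + y' i" "\<And>i. r i = s * v'' i + y'' i"
  shows "weight p q r"
proof -
  have "p = (\<lambda>i. s * v i + y i)" "q = (\<lambda>i. s * v' i + y' i)" "r = (\<lambda>i. s * v'' i + y'' i)"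
    using assms(4-6) by (simp_all add: fun_eq_iff)
  then show ?thesis using weight_add[OF weight_scale[OF assms(1,2)] assms(3)] by simp
qed

lemma weight_six:
  assumes "weight v1 w1 x1" "weight v2 w2 x2" "weight v3 w3 x3" "weight v4 w4 x4" "weight v5 w5 x5" "weight v6 w6 x6"
    and "0 \<le> a1" "0 \<le> a2" "0 \<le> a3" "0 \<le> a4" "0 \<le> a5" "0 \<le> a6"
    and "\<forall>i. p i = a1 * v1 i + (a2 * v2 i + (a3 * v3 i + (a4 * v4 i + (a5 * v5 i + a6 * v6 i))))"
    and "\<forall>i. q i = a1 * w1 i + (a2 * w2 i + (a3 * w3 i + (a4 * w4 i + (a5 * w5 i + a6 * w6 i))))"
    and "\<forall>i. r i = a1 * x1 i + (a2 * x2 i + (a3 * x3 i + (a4 * x4 i + (a5 * x5 i + a6 * x6 i))))"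
  shows "weight p q r"
  apply (rule weight_combine[OF assms(1,7) weight_combine[OF assms(2,8) weight_combine[OF assms(3,9)
    weight_combine[OF assms(4,10) weight_combine[OF assms(5,11) weight_scale[OF assms(6,12)]]]]]])
                apply (rule refl)+
  using assms(13-15) apply blast+
  done

text \<open>The slacks are right side minus left side of the seven inequalities, with
  \<open>p\<close>, \<open>q\<close>, \<open>r\<close> in the roles of the particles
  \<open>a\<close>, \<open>b\<close>, \<open>c\<close>.\<close>

definition slack1 :: "(3 \<Rightarrow> real) \<Rightarrow> (3 \<Rightarrow> real) \<Rightarrow> (3 \<Rightarrow> real) \<Rightarrow> real" where
  "slack1 p q r = q 2 + q 1 + r 2 + r 1 - p 2 - p 1"
definition slack2 :: "(3 \<Rightarrow> real) \<Rightarrow> (3 \<Rightarrow> real) \<Rightarrow> (3 \<Rightarrow> real) \<Rightarrow> real" where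
  "slack2 p q r = q 2 + q 1 + r 3 + r 1 - p 3 - p 1"
definition slack3 :: "(3 \<Rightarrow> real) \<Rightarrow> (3 \<Rightarrow> real) \<Rightarrow> (3 \<Rightarrow> real) \<Rightarrow> real" where
  "slack3 p q r = q 2 + q 1 + r 2 + r 3 - p 2 - p 3"
definition slack4 :: "(3 \<Rightarrow> real) \<Rightarrow> (3 \<Rightarrow> real) \<Rightarrow> (3 \<Rightarrow> real) \<Rightarrow> real" where
  "slack4 p q r = 2 * q 2 + q 1 + 2 * r 2 + r 1 - 2 * p 2 - p 1"
definition slack5 :: "(3 \<Rightarrow> real) \<Rightarrow> (3 \<Rightarrow> real) \<Rightarrow> (3 \<Rightarrow> real) \<Rightarrow> real" where
  "slack5 p q r = 2 * q 2 + q 1 + 2 * r 1 + r 2 - 2 * p 1 - p 2"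
definition slack6 :: "(3 \<Rightarrow> real) \<Rightarrow> (3 \<Rightarrow> real) \<Rightarrow> (3 \<Rightarrow> real) \<Rightarrow> real" where
  "slack6 p q r = 2 * q 2 + q 1 + 2 * r 2 + r 3 - 2 * p 2 - p 3"
definition slack7 :: "(3 \<Rightarrow> real) \<Rightarrow> (3 \<Rightarrow> real) \<Rightarrow> (3 \<Rightarrow> real) \<Rightarrow> real" where
  "slack7 p q r = 2 * q 1 + q 2 + 2 * r 3 + r 2 - 2 * p 2 - p 3"

lemmas slack_defs = slack1_def slack2_def slack3_def slack4_def slack5_def slack6_def slack7_def

definition "slacks = {slack1, slack2, slack3, slack4, slack5, slack6, slack7}"

definition "perm_slacks = (\<Union>g\<in>slacks. {\<lambda>p q r. g p q r, \<lambda>p q r. g p r q, \<lambda>p q r. g q p r,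
   \<lambda>p q r. g q r p, \<lambda>p q r. g r p q, \<lambda>p q r. g r q p})"

text \<open>The sum \<open>s\<close> is a parameter because subtracting multiples of vertices lowers
  it; the polytopes for all \<open>s\<close> together form a cone.\<close>

definition chamber :: "real \<Rightarrow> (3 \<Rightarrow> real) \<Rightarrow> bool" where
  "chamber s p \<longleftrightarrow> 0 \<le> p 1 \<and> p 1 \<le> p 2 \<and> p 2 \<le> p 3 \<and> p 1 + p 2 + p 3 = s"

definition polytope3 :: "real \<Rightarrow> (3 \<Rightarrow> real) \<Rightarrow> (3 \<Rightarrow> real) \<Rightarrow> (3 \<Rightarrow> real) \<Rightarrow> bool" where
  "polytope3 s p q r \<longleftrightarrow> chamber s p \<and> chamber s q \<and> chamber s r \<and> (\<forall>h\<in>perm_slacks. 0 \<le> h p q r)"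

lemma polytope3_slack:
  assumes "polytope3 s p q r" "g \<in> slacks"
  shows "0 \<le> g p q r" "0 \<le> g p r q" "0 \<le> g q p r" "0 \<le> g q r p" "0 \<le> g r p q" "0 \<le> g r q p"
  using assms by (auto simp: polytope3_def perm_slacks_def)

lemma polytope3_chamber:
  assumes "polytope3 s p q r"
  shows "chamber s p" "chamber s q" "chamber s r"
  using assms by (simp_all add: polytope3_def)

lemma polytope3_sum:
  assumes "polytope3 s p q r"
  shows "p 1 + p 2 + p 3 = s" "q 1 + q 2 + q 3 = s" "r 1 + r 2 + r 3 = s"
  using polytope3_chamber[OF assms] by (simp_all add: chamber_def)

lemma polytope3_swap:
  "polytope3 s p q r \<Longrightarrow> polytope3 s q p r" "polytope3 s p q r \<Longrightarrow> polytope3 s r q p"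
  by (auto simp: polytope3_def perm_slacks_def)

lemma polytope3_perms:
  assumes "polytope3 s p q r"
  shows "polytope3 s p r q" "polytope3 s q p r" "polytope3 s q r p" "polytope3 s r p q" "polytope3 s r q p"
  using polytope3_swap(2)[OF polytope3_swap(1)[OF polytope3_swap(2)[OF assms]]] polytope3_swap(1)[OF polytope3_swap(2)[OF assms]]
    polytope3_swap(2)[OF polytope3_swap(1)[OF assms]] polytope3_swap[OF assms] by blast+

lemmas weight_vertices = weight_generators weight_generators[THEN weight_perms(1)] weight_generators[THEN weight_perms(2)]
  weight_generators[THEN weight_perms(3)] weight_generators[THEN weight_perms(4)] weight_generators[THEN weight_perms(5)]

text \<open>
  Each facet \<open>slack = 0\<close> is a simplex with six vertices. The coefficient of a vertex in the
  convex combination is the slack of the inequality that defines the opposite face.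
\<close>

lemma facet1:
  assumes P: "polytope3 s p q r" and tight: "slack1 p q r = 0"
  shows "weight p q r"
proof (rule weight_six)
  show "weight (vec3 1 1 1) (vec3 0 1 2) (vec3 0 1 2)"
    by (rule weight_vertices)
  show "weight (vec3 0 1 1) (vec3 0 1 1) (vec3 0 0 2)"
    by (rule weight_vertices)
  show "weight (vec3 1 1 1) (vec3 1 1 1) (vec3 0 0 3)"
    by (rule weight_vertices)
  show "weight (vec3 0 1 1) (vec3 0 0 2) (vec3 0 1 1)"
    by (rule weight_vertices)
  show "weight (vec3 1 1 1) (vec3 0 0 3) (vec3 1 1 1)"
    by (rule weight_vertices)
  show "weight (vec3 0 0 1) (vec3 0 0 1) (vec3 0 0 1)"
    by (rule weight_vertices)
  show "0 \<le> slack4 p q r"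
    using polytope3_slack(1)[OF P] by (simp add: slacks_def)
  show "0 \<le> slack5 p q r"
    using polytope3_slack(1)[OF P] by (simp add: slacks_def)
  show "0 \<le> q 1"
    using polytope3_chamber(2)[OF P] by (simp add: chamber_def)
  show "0 \<le> slack5 p r q"
    using polytope3_slack(2)[OF P] by (simp add: slacks_def)
  show "0 \<le> r 1"
    using polytope3_chamber(3)[OF P] by (simp add: chamber_def)
  show "0 \<le> p 3 - p 2"
    using polytope3_chamber(1)[OF P] by (simp add: chamber_def)
\<comment> \<open>The vertices are scaled so that the slacks themselves are the coefficients. The
  nine coordinate identities then follow linearly from tightness and the common sum
  \<open>s\<close>.\<close>
qed ((unfold forall_3 vec3_simps slack_defs ring_distribs mult_1_right mult_zero_right; intro conjI;
  use polytope3_sum[OF P] tight[unfolded slack_defs] in linarith)+)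

lemma facet2:
  assumes P: "polytope3 s p q r" and tight: "slack2 p q r = 0"
  shows "weight p q r"
proof (rule weight_six)
  show "weight (vec3 1 1 2) (vec3 0 1 3) (vec3 0 2 2)"
    by (rule weight_vertices)
  show "weight (vec3 1 1 4) (vec3 1 1 4) (vec3 0 3 3)"
    by (rule weight_vertices)
  show "weight (vec3 0 0 2) (vec3 0 1 1) (vec3 0 1 1)"
    by (rule weight_vertices)
  show "weight (vec3 0 1 1) (vec3 0 0 2) (vec3 0 1 1)"
    by (rule weight_vertices)
  show "weight (vec3 1 1 1) (vec3 0 0 3) (vec3 1 1 1)"
    by (rule weight_vertices)
  show "weight (vec3 0 0 1) (vec3 0 0 1) (vec3 0 0 1)"
    by (rule weight_vertices)
  show "0 \<le> slack4 r p q"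
    using polytope3_slack(5)[OF P] by (simp add: slacks_def)
  show "0 \<le> q 1"
    using polytope3_chamber(2)[OF P] by (simp add: chamber_def)
  show "0 \<le> slack6 r q p"
    using polytope3_slack(6)[OF P] by (simp add: slacks_def)
  show "0 \<le> p 2 - p 1"
    using polytope3_chamber(1)[OF P] by (simp add: chamber_def)
  show "0 \<le> r 1"
    using polytope3_chamber(3)[OF P] by (simp add: chamber_def)
  show "0 \<le> r 3 - r 2"
    using polytope3_chamber(3)[OF P] by (simp add: chamber_def)
qed ((unfold forall_3 vec3_simps slack_defs ring_distribs mult_1_right mult_zero_right; intro conjI;
  use polytope3_sum[OF P] tight[unfolded slack_defs] in linarith)+)

lemma facet3:
  assumes P: "polytope3 s p q r" and tight: "slack3 p q r = 0"
  shows "weight p q r"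
proof (rule weight_six)
  show "weight (vec3 0 2 2) (vec3 0 1 3) (vec3 1 1 2)"
    by (rule weight_vertices)
  show "weight (vec3 0 3 3) (vec3 1 1 4) (vec3 2 2 2)"
    by (rule weight_vertices)
  show "weight (vec3 0 1 1) (vec3 0 0 2) (vec3 0 1 1)"
    by (rule weight_vertices)
  show "weight (vec3 1 1 1) (vec3 0 0 3) (vec3 1 1 1)"
    by (rule weight_vertices)
  show "weight (vec3 0 0 1) (vec3 0 0 1) (vec3 0 0 1)"
    by (rule weight_vertices)
  show "weight (vec3 0 1 2) (vec3 0 1 2) (vec3 1 1 1)"
    by (rule weight_vertices)
  show "0 \<le> slack5 r q p"
    using polytope3_slack(6)[OF P] by (simp add: slacks_def)
  show "0 \<le> q 1"
    using polytope3_chamber(2)[OF P] by (simp add: chamber_def)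
  show "0 \<le> r 2 - r 1"
    using polytope3_chamber(3)[OF P] by (simp add: chamber_def)
  show "0 \<le> p 1"
    using polytope3_chamber(1)[OF P] by (simp add: chamber_def)
  show "0 \<le> slack7 p q r"
    using polytope3_slack(1)[OF P] by (simp add: slacks_def)
  show "0 \<le> slack6 p q r"
    using polytope3_slack(1)[OF P] by (simp add: slacks_def)
qed ((unfold forall_3 vec3_simps slack_defs ring_distribs mult_1_right mult_zero_right; intro conjI;
  use polytope3_sum[OF P] tight[unfolded slack_defs] in linarith)+)

lemma facet4:
  assumes P: "polytope3 s p q r" and tight: "slack4 p q r = 0"
  shows "weight p q r"
proof (rule weight_six)
  show "weight (vec3 0 3 3) (vec3 1 1 4) (vec3 1 1 4)"
    by (rule weight_vertices)
  show "weight (vec3 0 1 1) (vec3 0 1 1) (vec3 0 0 2)"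
    by (rule weight_vertices)
  show "weight (vec3 1 1 1) (vec3 1 1 1) (vec3 0 0 3)"
    by (rule weight_vertices)
  show "weight (vec3 0 1 1) (vec3 0 0 2) (vec3 0 1 1)"
    by (rule weight_vertices)
  show "weight (vec3 1 1 1) (vec3 0 0 3) (vec3 1 1 1)"
    by (rule weight_vertices)
  show "weight (vec3 0 0 1) (vec3 0 0 1) (vec3 0 0 1)"
    by (rule weight_vertices)
  show "0 \<le> slack1 p q r"
    using polytope3_slack(1)[OF P] by (simp add: slacks_def)
  show "0 \<le> q 2 - q 1"
    using polytope3_chamber(2)[OF P] by (simp add: chamber_def)
  show "0 \<le> slack2 r q p"
    using polytope3_slack(6)[OF P] by (simp add: slacks_def)
  show "0 \<le> r 2 - r 1"
    using polytope3_chamber(3)[OF P] by (simp add: chamber_def)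
  show "0 \<le> slack2 q r p"
    using polytope3_slack(4)[OF P] by (simp add: slacks_def)
  show "0 \<le> p 3 - p 2"
    using polytope3_chamber(1)[OF P] by (simp add: chamber_def)
qed ((unfold forall_3 vec3_simps slack_defs ring_distribs mult_1_right mult_zero_right; intro conjI;
  use polytope3_sum[OF P] tight[unfolded slack_defs] in linarith)+)

lemma facet5:
  assumes P: "polytope3 s p q r" and tight: "slack5 p q r = 0"
  shows "weight p q r"
proof (rule weight_six)
  show "weight (vec3 1 1 1) (vec3 0 1 2) (vec3 0 1 2)"
    by (rule weight_vertices)
  show "weight (vec3 2 2 2) (vec3 1 1 4) (vec3 0 3 3)"
    by (rule weight_vertices)
  show "weight (vec3 1 1 1) (vec3 1 1 1) (vec3 0 0 3)"
    by (rule weight_vertices)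
  show "weight (vec3 0 1 1) (vec3 0 0 2) (vec3 0 1 1)"
    by (rule weight_vertices)
  show "weight (vec3 1 1 1) (vec3 0 0 3) (vec3 1 1 1)"
    by (rule weight_vertices)
  show "weight (vec3 0 0 1) (vec3 0 0 1) (vec3 0 0 1)"
    by (rule weight_vertices)
  show "0 \<le> q 2 - q 1"
    using polytope3_chamber(2)[OF P] by (simp add: chamber_def)
  show "0 \<le> slack1 p q r"
    using polytope3_slack(1)[OF P] by (simp add: slacks_def)
  show "0 \<le> slack3 r q p"
    using polytope3_slack(6)[OF P] by (simp add: slacks_def)
  show "0 \<le> p 2 - p 1"
    using polytope3_chamber(1)[OF P] by (simp add: chamber_def)
  show "0 \<le> r 1"
    using polytope3_chamber(3)[OF P] by (simp add: chamber_def)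
  show "0 \<le> p 3 - p 2"
    using polytope3_chamber(1)[OF P] by (simp add: chamber_def)
qed ((unfold forall_3 vec3_simps slack_defs ring_distribs mult_1_right mult_zero_right; intro conjI;
  use polytope3_sum[OF P] tight[unfolded slack_defs] in linarith)+)

lemma facet6:
  assumes P: "polytope3 s p q r" and tight: "slack6 p q r = 0"
  shows "weight p q r"
proof (rule weight_six)
  show "weight (vec3 0 2 2) (vec3 0 1 3) (vec3 1 1 2)"
    by (rule weight_vertices)
  show "weight (vec3 0 3 3) (vec3 1 1 4) (vec3 1 1 4)"
    by (rule weight_vertices)
  show "weight (vec3 0 3 3) (vec3 1 1 4) (vec3 2 2 2)"
    by (rule weight_vertices)
  show "weight (vec3 0 1 1) (vec3 0 0 2) (vec3 0 1 1)"
    by (rule weight_vertices)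
  show "weight (vec3 1 1 1) (vec3 0 0 3) (vec3 1 1 1)"
    by (rule weight_vertices)
  show "weight (vec3 0 0 1) (vec3 0 0 1) (vec3 0 0 1)"
    by (rule weight_vertices)
  show "0 \<le> q 2 - q 1"
    using polytope3_chamber(2)[OF P] by (simp add: chamber_def)
  show "0 \<le> slack3 p q r"
    using polytope3_slack(1)[OF P] by (simp add: slacks_def)
  show "0 \<le> slack2 r q p"
    using polytope3_slack(6)[OF P] by (simp add: slacks_def)
  show "0 \<le> r 2 - r 1"
    using polytope3_chamber(3)[OF P] by (simp add: chamber_def)
  show "0 \<le> p 1"
    using polytope3_chamber(1)[OF P] by (simp add: chamber_def)
  show "0 \<le> p 3 - p 2"
    using polytope3_chamber(1)[OF P] by (simp add: chamber_def)
qed ((unfold forall_3 vec3_simps slack_defs ring_distribs mult_1_right mult_zero_right; intro conjI;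
  use polytope3_sum[OF P] tight[unfolded slack_defs] in linarith)+)

lemma facet7:
  assumes P: "polytope3 s p q r" and tight: "slack7 p q r = 0"
  shows "weight p q r"
proof (rule weight_six)
  show "weight (vec3 0 2 2) (vec3 0 1 3) (vec3 1 1 2)"
    by (rule weight_vertices)
  show "weight (vec3 0 3 3) (vec3 0 3 3) (vec3 2 2 2)"
    by (rule weight_vertices)
  show "weight (vec3 0 3 3) (vec3 1 1 4) (vec3 2 2 2)"
    by (rule weight_vertices)
  show "weight (vec3 0 1 1) (vec3 0 0 2) (vec3 0 1 1)"
    by (rule weight_vertices)
  show "weight (vec3 1 1 1) (vec3 0 0 3) (vec3 1 1 1)"
    by (rule weight_vertices)
  show "weight (vec3 0 1 2) (vec3 0 1 2) (vec3 1 1 1)"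
    by (rule weight_vertices)
  show "0 \<le> r 3 - r 2"
    using polytope3_chamber(3)[OF P] by (simp add: chamber_def)
  show "0 \<le> slack3 p q r"
    using polytope3_slack(1)[OF P] by (simp add: slacks_def)
  show "0 \<le> q 1"
    using polytope3_chamber(2)[OF P] by (simp add: chamber_def)
  show "0 \<le> r 2 - r 1"
    using polytope3_chamber(3)[OF P] by (simp add: chamber_def)
  show "0 \<le> p 1"
    using polytope3_chamber(1)[OF P] by (simp add: chamber_def)
  show "0 \<le> p 3 - p 2"
    using polytope3_chamber(1)[OF P] by (simp add: chamber_def)
qed ((unfold forall_3 vec3_simps slack_defs ring_distribs mult_1_right mult_zero_right; intro conjI;
  use polytope3_sum[OF P] tight[unfolded slack_defs] in linarith)+)

lemma facet:
  assumes "polytope3 s p q r" "g \<in> slacks" "g p q r = 0"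
  shows "weight p q r"
  using assms by (auto simp: slacks_def intro: facet1 facet2 facet3 facet4 facet5 facet6 facet7)

lemma perm_facet:
  assumes P: "polytope3 s p q r" and h: "h \<in> perm_slacks" "h p q r = 0"
  shows "weight p q r"
proof -
  obtain g where g: "g \<in> slacks" and
    "g p q r = 0 \<or> g p r q = 0 \<or> g q p r = 0 \<or> g q r p = 0 \<or> g r p q = 0 \<or> g r q p = 0"
    using h by (auto simp: perm_slacks_def)
  then have "weight p q r \<or> weight p r q \<or> weight q p r \<or> weight q r p \<or> weight r p q \<or> weight r q p"
    using P polytope3_perms[OF P] facet by meson
  then show ?thesis using weight_perms by blast
qed

text \<open>
  A vertex of the polytope lying on the same walls \<open>p 1 = p 2\<close> as the given point. Moving away from it
  until an inequality becomes tight leads to a facet or to one more wall.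
\<close>

definition apex :: "(3 \<Rightarrow> real) \<Rightarrow> 3 \<Rightarrow> real" where
  "apex p = (if p 1 = p 2 then vec3 2 2 2 else vec3 0 3 3)"

text \<open>With none, one, two or three spectra on a wall, the apex comes from
  \<open>hyperdet\<close>, \<open>bracket6\<close>, \<open>pencil_disc\<close> or
  \<open>slice_aronhold\<close>, rescaled so that each spectrum has sum 6.\<close>

lemma weight_apex: "weight (apex p) (apex q) (apex r)"
proof -
  have v: "(\<lambda>i. c * vec3 x y z i) = vec3 (c * x) (c * y) (c * z)" for c x y z :: real
    by (auto simp: vec3_def)
  have "weight (vec3 0 3 3) (vec3 0 3 3) (vec3 0 3 3)"
    using weight_scale[OF weight_generators(4), of "3 / 2"] unfolding v by simp
  moreover have "weight (vec3 2 2 2) (vec3 2 2 2) (vec3 0 3 3)"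
    using weight_scale[OF weight_perms(5)[OF weight_generators(10)], of "1 / 2"] unfolding v by simp
  moreover have "weight (vec3 2 2 2) (vec3 2 2 2) (vec3 2 2 2)"
    using weight_scale[OF weight_generators(11), of "1 / 2"] unfolding v by simp
  moreover note weight_generators(7)
  ultimately show ?thesis
    unfolding apex_def by (auto dest: weight_perms)
qed

lemma slack_apex:
  "g \<in> slacks \<Longrightarrow> 0 \<le> g (apex p) (apex q) (apex r)"
  by (auto simp: slacks_def slack_defs apex_def)

lemma perm_slack_apex:
  "h \<in> perm_slacks \<Longrightarrow> 0 \<le> h (apex p) (apex q) (apex r)"
  by (auto simp: perm_slacks_def slack_apex)

lemma slack_linear:
  assumes "h \<in> perm_slacks"
  shows "h (\<lambda>i. p i - s * v i) (\<lambda>i. q i - s * v' i) (\<lambda>i. r i - s * v'' i) = h p q r - s * h v v' v''"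
  using assms by (auto simp: perm_slacks_def slacks_def slack_defs algebra_simps)

text \<open>Differences \<open>p 3 - p 2\<close> do not change on subtracting an apex, whose last
  two entries agree, and nonnegativity of \<open>p 1\<close> is recovered from the slacks.\<close>

definition walls :: "((3 \<Rightarrow> real) \<Rightarrow> (3 \<Rightarrow> real) \<Rightarrow> (3 \<Rightarrow> real) \<Rightarrow> real) set" where
  "walls = {\<lambda>p q r. p 2 - p 1, \<lambda>p q r. q 2 - q 1, \<lambda>p q r. r 2 - r 1}"

lemma wall_linear:
  assumes "h \<in> walls"
  shows "h (\<lambda>i. p i - s * v i) (\<lambda>i. q i - s * v' i) (\<lambda>i. r i - s * v'' i) = h p q r - s * h v v' v''"
  using assms by (auto simp: walls_def algebra_simps)

lemma wall_nonneg:
  assumes "h \<in> walls"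
  shows "0 \<le> h (apex p) (apex q) (apex r)" "polytope3 s p q r \<Longrightarrow> 0 \<le> h p q r"
  using assms by (auto simp: walls_def apex_def polytope3_def chamber_def)

text \<open>Induction on the number of spectra off their wall: subtract the largest admissible
  multiple of the apex and add it back by convexity of the cone.\<close>

lemma weight_of_polytope:
  assumes "polytope3 s p q r"
  shows "weight p q r"
proof -
  define free :: "(3 \<Rightarrow> real) \<Rightarrow> nat" where "free p = (if p 1 = p 2 then 0 else 1)" for p
  show ?thesis using assms
  proof (induction "free p + free q + free r" arbitrary: s p q r rule: less_induct)
    case less
    let ?H = "{h \<in> perm_slacks \<union> walls. 0 < h (apex p) (apex q) (apex r)}"
    let ?f = "\<lambda>h. h p q r / h (apex p) (apex q) (apex r)"
    \<comment> \<open>The largest multiple of the apex that can be subtracted before some slack or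
      wall function becomes negative.\<close>
    define c where "c = Min (?f ` ?H)"
    have fin: "finite ?H" by (simp add: perm_slacks_def slacks_def walls_def)
    have "slack1 \<in> ?H"
      by (auto simp: perm_slacks_def slacks_def slack1_def apex_def)
    then have ne: "?f ` ?H \<noteq> {}" by blast
    have nn: "0 \<le> h p q r" "0 \<le> h (apex p) (apex q) (apex r)" if "h \<in> perm_slacks \<union> walls" for h
      using that less.prems perm_slack_apex wall_nonneg unfolding polytope3_def by blast+
    have c0: "0 \<le> c" unfolding c_def using fin ne nn by (subst Min_ge_iff) auto
    have c_le: "c * h (apex p) (apex q) (apex r) \<le> h p q r" if "h \<in> perm_slacks \<union> walls" for h
    proof (cases "h \<in> ?H")
      case True
      then have "c \<le> ?f h" unfolding c_def using fin by (intro Min_le) auto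
      then show ?thesis using True by (simp add: field_simps)
    next
      case False
      then have "h (apex p) (apex q) (apex r) = 0" using nn(2)[OF that] that by force
      then show ?thesis using nn(1)[OF that] by simp
    qed
    have "c \<in> ?f ` ?H" unfolding c_def by (rule Min_in[OF finite_imageI[OF fin] ne])
    then obtain h where h: "h \<in> ?H" "c = ?f h" by (rule imageE)
    define p' q' r' where y: "p' = (\<lambda>i. p i - c * apex p i)" "q' = (\<lambda>i. q i - c * apex q i)" "r' = (\<lambda>i. r i - c * apex r i)"
    have lin: "h p' q' r' = h p q r - c * h (apex p) (apex q) (apex r)" if "h \<in> perm_slacks \<union> walls" for h
      using that slack_linear wall_linear unfolding y by blast
    have ge: "0 \<le> h p' q' r'" if "h \<in> perm_slacks \<union> walls" for h
      using lin[OF that] c_le[OF that] by simp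
    have tight: "h p' q' r' = 0" using lin[of h] h by auto
    \<comment> \<open>The two slacks add up to \<open>2 * (p' 1 + p' 2)\<close>. On the wall this
      gives \<open>p' 1 \<ge> 0\<close>; off the wall the first entry of the apex is 0, so
      \<open>p' 1 = p 1\<close>.\<close>
    have pos: "0 \<le> p' 1" if "chamber s p" "p' = (\<lambda>i. p i - c * apex p i)"
        "0 \<le> slack3 q' p' r'" "0 \<le> slack3 r' p' q'" for p p' q' r' :: "3 \<Rightarrow> real"
      using that by (auto simp: chamber_def apex_def slack3_def split: if_splits)
    have s3: "0 \<le> slack3 p' q' r'" "0 \<le> slack3 p' r' q'" "0 \<le> slack3 q' p' r'" "0 \<le> slack3 q' r' p'"
       "0 \<le> slack3 r' p' q'" "0 \<le> slack3 r' q' p'"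
      using ge by (auto simp: perm_slacks_def slacks_def)
    have sw: "0 \<le> p' 2 - p' 1" "0 \<le> q' 2 - q' 1" "0 \<le> r' 2 - r' 1"
      using ge[of "\<lambda>p q r. p 2 - p 1"] ge[of "\<lambda>p q r. q 2 - q 1"] ge[of "\<lambda>p q r. r 2 - r 1"]
      by (simp_all add: walls_def)
    have ch: "chamber s p" "chamber s q" "chamber s r" using less.prems by (auto simp: polytope3_def)
    have ch': "chamber (s - 6 * c) p'" if "chamber s p" "p' = (\<lambda>i. p i - c * apex p i)" "0 \<le> p' 1" "0 \<le> p' 2 - p' 1" for p p'
      using that by (auto simp: chamber_def apex_def split: if_splits)
    have P': "polytope3 (s - 6 * c) p' q' r'"
      unfolding polytope3_def using ge ch' ch y pos s3 sw by blast
    have "weight p' q' r'"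
    proof (cases "h \<in> perm_slacks")
      case True
      then show ?thesis using perm_facet[OF P'] tight by blast
    next
      case False
      have "free p' \<le> free p" "free q' \<le> free q" "free r' \<le> free r"
        by (auto simp: free_def y apex_def)
      \<comment> \<open>The tight function is a wall function that is positive at the apex, so its
        spectrum was off the wall before and is on it now.\<close>
      moreover have "free p' < free p \<or> free q' < free q \<or> free r' < free r"
        using False h tight by (auto simp: free_def walls_def apex_def split: if_splits)
      ultimately show ?thesis using less.hyps[OF _ P'] by linarith
    qed
    then show "weight p q r"
      by (rule weight_combine[OF weight_apex[of p q r] c0]) (simp_all add: y)
  qed
qed

section \<open>Necessity of the inequalities\<close>

definition cinner :: "(3 \<Rightarrow> complex) \<Rightarrow> (3 \<Rightarrow> complex) \<Rightarrow> complex" where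
  "cinner x y = (\<Sum>m\<in>UNIV. cnj (x m) * y m)"

definition orthonormal :: "(3 \<Rightarrow> 3 \<Rightarrow> complex) \<Rightarrow> bool" where
  "orthonormal u \<longleftrightarrow> (\<forall>i j. cinner (u i) (u j) = (if i = j then 1 else 0))"

lemma cinner_commute: "cnj (cinner x y) = cinner y x"
  by (simp add: cinner_def mult.commute)

lemma cinner_eq_0_commute: "cinner x y = 0 \<longleftrightarrow> cinner y x = 0"
  by (metis cinner_commute complex_cnj_zero)

text \<open>Completeness relation: a left inverse of a square matrix is also a right
  inverse.\<close>

lemma orthonormalD:
  assumes "orthonormal u"
  shows "(\<Sum>i\<in>UNIV. u i m * cnj (u i m')) = (if m = m' then 1 else 0)"
proof -
  define A :: "complex ^ 3 ^ 3" where "A = (\<chi> i m. cnj (u i m))"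
  define B :: "complex ^ 3 ^ 3" where "B = (\<chi> m i. u i m)"
  have "A ** B = Finite_Cartesian_Product.mat 1"
    using assms by (simp add: A_def B_def matrix_matrix_mult_def Finite_Cartesian_Product.mat_def orthonormal_def cinner_def vec_eq_iff)
  then have "B ** A = Finite_Cartesian_Product.mat 1"
    by (simp add: matrix_left_right_inverse)
  then have "vec_nth (vec_nth (B ** A) m) m' = vec_nth (vec_nth (Finite_Cartesian_Product.mat 1) m) m'"
    by simp
  then show ?thesis
    by (simp add: A_def B_def matrix_matrix_mult_def Finite_Cartesian_Product.mat_def)
qed

text \<open>A matrix with rows \<open>x\<close>, \<open>y\<close> and 0 is singular; conjugating and
  normalizing a kernel vector gives \<open>n\<close>.\<close>

lemma unit_orthogonal:
  obtains n where "cinner n n = 1" "cinner n x = 0" "cinner n y = 0"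
proof -
  define A :: "complex ^ 3 ^ 3" where "A = (\<chi> i j. if i = 1 then x j else if i = 2 then y j else 0)"
  have "\<not> (\<exists>B. B ** A = Finite_Cartesian_Product.mat 1)"
  proof
    assume "\<exists>B. B ** A = Finite_Cartesian_Product.mat 1"
    then obtain B where "A ** B = Finite_Cartesian_Product.mat 1" using matrix_left_right_inverse by blast
    then have "vec_nth (vec_nth (A ** B) 3) 3 = vec_nth (vec_nth (Finite_Cartesian_Product.mat 1 :: complex ^ 3 ^ 3) 3) 3"
      by simp
    then show False by (simp add: A_def matrix_matrix_mult_def Finite_Cartesian_Product.mat_def)
  qed
  then obtain v where v: "A *v v = 0" "v \<noteq> 0" using matrix_left_invertible_ker by blast
  then have "vec_nth (A *v v) 1 = 0" "vec_nth (A *v v) 2 = 0" by simp_all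
  then have xy: "(\<Sum>j\<in>UNIV. vec_nth v j * x j) = 0" "(\<Sum>j\<in>UNIV. vec_nth v j * y j) = 0"
    by (simp_all add: A_def matrix_vector_mult_def mult.commute)
  have nv: "norm v > 0" using v by simp
  define n where "n j = cnj (vec_nth v j) / of_real (norm v)" for j
  have "cinner n z = (\<Sum>j\<in>UNIV. vec_nth v j * z j) / of_real (norm v)" for z
    by (simp add: cinner_def n_def sum_divide_distrib)
  moreover have "cinner n n = 1"
  proof -
    have "cinner n n = (\<Sum>j\<in>UNIV. of_real ((cmod (vec_nth v j))\<^sup>2)) / (of_real (norm v) * of_real (norm v))"
      by (simp add: cinner_def n_def sum_divide_distrib complex_norm_square del: of_real_power)
    also have "\<dots> = 1"
      using nv by (simp add: norm_vec_def L2_set_def sum_nonneg flip: of_real_sum of_real_power of_real_mult)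
    finally show ?thesis .
  qed
  ultimately show ?thesis using xy by (intro that[of n]) simp_all
qed

lemma orthonormal_vec3:
  assumes "cinner a a = 1" "cinner b b = 1" "cinner c c = 1" "cinner a b = 0" "cinner a c = 0" "cinner b c = 0"
  shows "orthonormal (vec3 a b c)"
  using assms cinner_eq_0_commute unfolding orthonormal_def forall_3 by simp

definition unit3 :: "3 \<Rightarrow> 3 \<Rightarrow> complex" where "unit3 m i = (if i = m then 1 else 0)"

lemma cinner_unit3 [simp]: "cinner (unit3 m) x = x m" "cinner x (unit3 m) = cnj (x m)"
  using exhaust_3[of m] by (auto simp: cinner_def unit3_def sum_3)

lemma orthonormal_unit3: "orthonormal unit3"
  by (simp add: orthonormal_def unit3_def)

section \<open>Change of orthonormal bases\<close>

definition contract :: "(3 \<Rightarrow> complex) \<Rightarrow> (3 \<Rightarrow> complex) \<Rightarrow> (3 \<Rightarrow> complex) \<Rightarrow> tensor \<Rightarrow> complex" where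
  "contract x y z t = cinner x (\<lambda>a. cinner y (\<lambda>b. cinner z (t a b)))"

lemma contract_second: "contract x y z t = cinner y (\<lambda>b. cinner x (\<lambda>a. cinner z (t a b)))"
  unfolding contract_def cinner_def sum_distrib_left by (subst sum.swap) (simp add: mult_ac)

definition change1 :: "(3 \<Rightarrow> 3 \<Rightarrow> complex) \<Rightarrow> tensor \<Rightarrow> tensor" where
  "change1 u t i j k = cinner (u i) (\<lambda>a. t a j k)"
definition change2 :: "(3 \<Rightarrow> 3 \<Rightarrow> complex) \<Rightarrow> tensor \<Rightarrow> tensor" where
  "change2 u t i j k = cinner (u j) (\<lambda>a. t i a k)"
definition change3 :: "(3 \<Rightarrow> 3 \<Rightarrow> complex) \<Rightarrow> tensor \<Rightarrow> tensor" where
  "change3 u t i j k = cinner (u k) (t i j)"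

lemma marginal1_change1:
  "marginal1 (change1 u t) i i' = (\<Sum>m\<in>UNIV. \<Sum>m'\<in>UNIV. cnj (u i m) * u i' m' * marginal1 t m m')"
  unfolding marginal1_def change1_def cinner_def sum_3 by (simp add: algebra_simps)

lemma parseval:
  assumes "orthonormal u"
  shows "(\<Sum>i\<in>UNIV. cinner (u i) x * cnj (cinner (u i) y)) = (\<Sum>m\<in>UNIV. x m * cnj (y m))"
proof -
  have "(\<Sum>i\<in>UNIV. cinner (u i) x * cnj (cinner (u i) y)) =
     (\<Sum>i\<in>UNIV. \<Sum>m\<in>UNIV. \<Sum>m'\<in>UNIV. x m * cnj (y m') * (u i m' * cnj (u i m)))"
    by (simp add: cinner_def sum_product mult_ac)
  also have "\<dots> = (\<Sum>m\<in>UNIV. \<Sum>m'\<in>UNIV. x m * cnj (y m') * (\<Sum>i\<in>UNIV. u i m' * cnj (u i m)))"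
    by (subst sum.swap, rule sum.cong, simp, subst sum.swap) (simp add: sum_distrib_left)
  also have "\<dots> = (\<Sum>m\<in>UNIV. x m * cnj (y m))"
    by (simp add: orthonormalD[OF assms] if_distrib cong: if_cong)
  finally show ?thesis .
qed

text \<open>The marginal sums over the second and third indices, so by Parseval a unitary change of
  basis there does not affect it.\<close>

lemma marginal1_change23:
  assumes "orthonormal u"
  shows "marginal1 (change2 u t) i i' = marginal1 t i i'" "marginal1 (change3 u t) i i' = marginal1 t i i'"
proof -
  have "marginal1 (change2 u t) i i' = (\<Sum>k\<in>UNIV. \<Sum>j\<in>UNIV. cinner (u j) (\<lambda>a. t i a k) * cnj (cinner (u j) (\<lambda>a. t i' a k)))"
    unfolding marginal1_def change2_def by (rule sum.swap)
  also have "\<dots> = marginal1 t i i'"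
    unfolding parseval[OF assms] marginal1_def by (rule sum.swap)
  finally show "marginal1 (change2 u t) i i' = marginal1 t i i'" .
  show "marginal1 (change3 u t) i i' = marginal1 t i i'"
    unfolding marginal1_def change3_def parseval[OF assms] ..
qed

lemma swap_change:
  "swap12 (change1 u t) = change2 u (swap12 t)" "swap12 (change2 u t) = change1 u (swap12 t)"
  "swap12 (change3 u t) = change3 u (swap12 t)"
  "swap13 (change1 u t) = change3 u (swap13 t)" "swap13 (change2 u t) = change2 u (swap13 t)"
  "swap13 (change3 u t) = change1 u (swap13 t)"
  by (simp_all add: fun_eq_iff swap12_def[abs_def] swap13_def[abs_def] change1_def change2_def change3_def)

text \<open>The expectation value of the diagonal matrix with entries \<open>p\<close> at the vector
  \<open>x\<close>.\<close>

definition occupation :: "(3 \<Rightarrow> real) \<Rightarrow> (3 \<Rightarrow> complex) \<Rightarrow> real" where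
  "occupation p x = (\<Sum>m\<in>UNIV. p m * (cmod (x m))\<^sup>2)"

definition frame :: "(3 \<Rightarrow> 3 \<Rightarrow> complex) \<Rightarrow> (3 \<Rightarrow> 3 \<Rightarrow> complex) \<Rightarrow> (3 \<Rightarrow> 3 \<Rightarrow> complex) \<Rightarrow> tensor \<Rightarrow> tensor" where
  "frame u v w t = change1 u (change2 v (change3 w t))"

lemma frame_contract: "frame u v w t i j k = contract (u i) (v j) (w k) t"
  by (simp add: frame_def change1_def change2_def change3_def contract_def)

lemma frame_marginals:
  assumes "orthonormal u" "orthonormal v" "orthonormal w"
  shows "marginal1 (frame u v w t) i i' = (\<Sum>m\<in>UNIV. \<Sum>m'\<in>UNIV. cnj (u i m) * u i' m' * marginal1 t m m')"
    "marginal1 (swap12 (frame u v w t)) i i' = (\<Sum>m\<in>UNIV. \<Sum>m'\<in>UNIV. cnj (v i m) * v i' m' * marginal1 (swap12 t) m m')"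
    "marginal1 (swap13 (frame u v w t)) i i' = (\<Sum>m\<in>UNIV. \<Sum>m'\<in>UNIV. cnj (w i m) * w i' m' * marginal1 (swap13 t) m m')"
proof -
  have comm: "change2 v (change1 u s) = change1 u (change2 v s)" "change3 v (change1 u s) = change1 u (change3 v s)" for u v s
    unfolding fun_eq_iff change1_def change2_def change3_def cinner_def sum_3 by (simp_all add: algebra_simps)
  show "marginal1 (frame u v w t) i i' = (\<Sum>m\<in>UNIV. \<Sum>m'\<in>UNIV. cnj (u i m) * u i' m' * marginal1 t m m')"
    unfolding frame_def marginal1_change1 marginal1_change23[OF assms(2)] marginal1_change23[OF assms(3)] ..
  show "marginal1 (swap12 (frame u v w t)) i i' = (\<Sum>m\<in>UNIV. \<Sum>m'\<in>UNIV. cnj (v i m) * v i' m' * marginal1 (swap12 t) m m')"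
    unfolding frame_def swap_change marginal1_change23[OF assms(1)] marginal1_change1 marginal1_change23[OF assms(3)] ..
  show "marginal1 (swap13 (frame u v w t)) i i' = (\<Sum>m\<in>UNIV. \<Sum>m'\<in>UNIV. cnj (w i m) * w i' m' * marginal1 (swap13 t) m m')"
    unfolding frame_def swap_change marginal1_change23[OF assms(1)] marginal1_change23[OF assms(2)] marginal1_change1 ..
qed

lemma marginal1_self: "marginal1 t i i = of_real (\<Sum>j\<in>UNIV. \<Sum>k\<in>UNIV. (cmod (t i j k))\<^sup>2)"
  by (simp add: marginal1_def complex_norm_square del: of_real_power)

lemma frame_occupation:
  assumes "diag_marginals t p q r" "orthonormal u" "orthonormal v" "orthonormal w"
  shows "(\<Sum>j\<in>UNIV. \<Sum>k\<in>UNIV. (cmod (frame u v w t i j k))\<^sup>2) = occupation p (u i)"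
    "(\<Sum>j\<in>UNIV. \<Sum>k\<in>UNIV. (cmod (frame u v w t j i k))\<^sup>2) = occupation q (v i)"
    "(\<Sum>j\<in>UNIV. \<Sum>k\<in>UNIV. (cmod (frame u v w t k j i))\<^sup>2) = occupation r (w i)"
proof -
  have diag: "(\<Sum>m\<in>UNIV. \<Sum>m'\<in>UNIV. cnj (x m) * x m' * (if m = m' then of_real (p m) else 0)) = of_real (occupation p x)"
    for x :: "3 \<Rightarrow> complex" and p :: "3 \<Rightarrow> real"
    unfolding occupation_def sum_3 by (simp add: complex_norm_square mult_ac del: of_real_power)
  note d = assms(1)[unfolded diag_marginals_def, THEN conjunct1, rule_format]
    assms(1)[unfolded diag_marginals_def, THEN conjunct2, THEN conjunct1, rule_format]
    assms(1)[unfolded diag_marginals_def, THEN conjunct2, THEN conjunct2, rule_format]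
  show "(\<Sum>j\<in>UNIV. \<Sum>k\<in>UNIV. (cmod (frame u v w t i j k))\<^sup>2) = occupation p (u i)"
    using frame_marginals(1)[OF assms(2-4), of t i i] unfolding d diag marginal1_self of_real_eq_iff .
  show "(\<Sum>j\<in>UNIV. \<Sum>k\<in>UNIV. (cmod (frame u v w t j i k))\<^sup>2) = occupation q (v i)"
    using frame_marginals(2)[OF assms(2-4), of t i i] unfolding d diag marginal1_self of_real_eq_iff swap12_def .
  show "(\<Sum>j\<in>UNIV. \<Sum>k\<in>UNIV. (cmod (frame u v w t k j i))\<^sup>2) = occupation r (w i)"
    using frame_marginals(3)[OF assms(2-4), of t i i] unfolding d diag marginal1_self of_real_eq_iff swap13_def .
qed

text \<open>Every nonzero coefficient in the new bases satisfies \<open>f i \<le> g j + h k\<close>.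
  Multiplying by its squared modulus and summing turns each weight into a sum over
  occupations.\<close>

lemma frame_inequality:
  assumes "diag_marginals t p q r" "orthonormal u" "orthonormal v" "orthonormal w"
    and zero: "\<forall>i j k. g j + h k < f i \<longrightarrow> contract (u i) (v j) (w k) t = 0"
  shows "(\<Sum>i\<in>UNIV. f i * occupation p (u i))
    \<le> (\<Sum>i\<in>UNIV. g i * occupation q (v i)) + (\<Sum>i\<in>UNIV. h i * occupation r (w i))"
proof -
  define X where "X i j k = (cmod (frame u v w t i j k))\<^sup>2" for i j k
  have "f i * X i j k \<le> g j * X i j k + h k * X i j k" for i j k
  proof (cases "g j + h k < f i")
    case True
    then show ?thesis using zero by (simp add: X_def frame_contract)
  next
    case False
    then have "f i * X i j k \<le> (g j + h k) * X i j k"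
      by (intro mult_right_mono) (auto simp: X_def)
    then show ?thesis by (simp add: distrib_right)
  qed
  then have "(\<Sum>i\<in>UNIV. \<Sum>j\<in>UNIV. \<Sum>k\<in>UNIV. f i * X i j k)
      \<le> (\<Sum>i\<in>UNIV. \<Sum>j\<in>UNIV. \<Sum>k\<in>UNIV. g j * X i j k + h k * X i j k)"
    by (intro sum_mono)
  also have "\<dots> = (\<Sum>j\<in>UNIV. g j * (\<Sum>i\<in>UNIV. \<Sum>k\<in>UNIV. X i j k))
      + (\<Sum>k\<in>UNIV. h k * (\<Sum>j\<in>UNIV. \<Sum>i\<in>UNIV. X i j k))"
    unfolding sum_3 by (simp add: algebra_simps)
  finally show ?thesis
    using frame_occupation[OF assms(1-4)] by (simp add: X_def sum_distrib_left[symmetric])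
qed

lemma occupation_sum:
  assumes "orthonormal u"
  shows "occupation p (u 1) + occupation p (u 2) + occupation p (u 3) = p 1 + p 2 + p 3"
proof -
  have "(\<Sum>i\<in>UNIV. (cmod (u i m))\<^sup>2) = 1" for m
  proof -
    have "of_real (\<Sum>i\<in>UNIV. (cmod (u i m))\<^sup>2) = (\<Sum>i\<in>UNIV. u i m * cnj (u i m))"
      by (simp add: complex_norm_square del: of_real_power)
    also have "\<dots> = of_real 1" using orthonormalD[OF assms, of m m] by simp
    finally show ?thesis by (simp only: of_real_eq_iff)
  qed
  then have "p m * (\<Sum>i\<in>UNIV. (cmod (u i m))\<^sup>2) = p m" for m by simp
  from this[of 1] this[of 2] this[of 3] show ?thesis
    unfolding occupation_def sum_3 by (simp add: algebra_simps)
qed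

lemma unit_norm:
  assumes "cinner x x = 1"
  shows "(cmod (x 1))\<^sup>2 + (cmod (x 2))\<^sup>2 + (cmod (x 3))\<^sup>2 = 1"
proof -
  have "of_real ((cmod (x 1))\<^sup>2 + (cmod (x 2))\<^sup>2 + (cmod (x 3))\<^sup>2) = cinner x x"
    by (simp add: cinner_def sum_3 complex_norm_square mult.commute del: of_real_power)
  also have "\<dots> = of_real 1" using assms by simp
  finally show ?thesis by (simp only: of_real_eq_iff)
qed

text \<open>For a unit vector the squared moduli are convex weights, so the occupation is a mean of
  the entries of \<open>p\<close>; a vanishing coordinate removes an extreme entry.\<close>

lemma occupation_bounds:
  assumes x: "cinner x x = 1" and p: "p 1 \<le> p 2" "p 2 \<le> p 3"
  shows "p 1 \<le> occupation p x" "occupation p x \<le> p 3"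
    "x 1 = 0 \<Longrightarrow> p 2 \<le> occupation p x" "x 3 = 0 \<Longrightarrow> occupation p x \<le> p 2"
proof -
  define a b c where ab: "a = (cmod (x 1))\<^sup>2" "b = (cmod (x 2))\<^sup>2" "c = (cmod (x 3))\<^sup>2"
  have n: "0 \<le> a" "0 \<le> b" "0 \<le> c" "a + b + c = 1"
    using unit_norm[OF x] by (simp_all add: ab)
  have o: "occupation p x = p 1 * a + p 2 * b + p 3 * c"
    by (simp add: occupation_def sum_3 ab)
  have m: "p 1 * b \<le> p 2 * b" "p 2 * c \<le> p 3 * c" "p 1 * a \<le> p 2 * a" "p 2 * a \<le> p 3 * a" "p 2 * b \<le> p 3 * b" "p 1 * c \<le> p 2 * c"
    using p n by (simp_all add: mult_right_mono)
  have t: "y * a + y * b + y * c = y" for y using n(4) by (simp flip: distrib_left)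
  show "p 1 \<le> occupation p x" using m t[of "p 1"] unfolding o by linarith
  show "occupation p x \<le> p 3" using m t[of "p 3"] unfolding o by linarith
  show "p 2 \<le> occupation p x" if "x 1 = 0"
    using m t[of "p 2"] that unfolding o by (simp add: ab)
  show "occupation p x \<le> p 2" if "x 3 = 0"
    using m t[of "p 2"] that unfolding o by (simp add: ab)
qed

lemma occupation_unit3 [simp]: "occupation p (unit3 m) = p m"
  using exhaust_3[of m] by (auto simp: occupation_def unit3_def sum_3)

lemma cinner_unit3_self: "cinner (unit3 m) (unit3 m) = 1"
  by (simp add: unit3_def)

section \<open>Orthonormal bases adapted to given vectors\<close>

lemma orthonormal_frame:
  assumes "cinner a a = 1" "cinner b b = 1" "cinner a b = 0"
  obtains c where "cinner c c = 1" "cinner c a = 0" "cinner c b = 0" "cinner a c = 0" "cinner b c = 0" "cinner b a = 0"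
  using unit_orthogonal[of a b] assms cinner_eq_0_commute by metis

lemma last_fixed_frame:
  obtains v1 v2 where "orthonormal (vec3 v1 v2 (unit3 3))" "cinner v1 y = 0"
    "cinner v1 v1 = 1" "cinner v2 v2 = 1" "v1 3 = 0" "v2 3 = 0"
proof -
  obtain v1 where v1: "cinner v1 v1 = 1" "cinner v1 (unit3 3) = 0" "cinner v1 y = 0"
    by (rule unit_orthogonal)
  obtain v2 where v2: "cinner v2 v2 = 1" "cinner v2 v1 = 0" "cinner v2 (unit3 3) = 0" "cinner v1 v2 = 0"
    using orthonormal_frame[OF v1(1) cinner_unit3_self v1(2)] by metis
  show ?thesis
    by (rule that[of v1 v2], rule orthonormal_vec3) (use v1 v2 in \<open>simp_all add: unit3_def\<close>)
qed

lemma first_fixed_frame: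
  obtains u2 u3 where "orthonormal (vec3 (unit3 1) u2 u3)" "cinner u2 x = 0"
    "cinner u2 u2 = 1" "u2 1 = 0" "u3 1 = 0"
proof -
  obtain u2 where u2: "cinner u2 u2 = 1" "cinner u2 (unit3 1) = 0" "cinner u2 x = 0"
    by (rule unit_orthogonal)
  obtain u3 where u3: "cinner u3 u3 = 1" "cinner u3 u2 = 0" "cinner u3 (unit3 1) = 0" "cinner u2 u3 = 0"
    using orthonormal_frame[OF u2(1) cinner_unit3_self u2(2)] by metis
  show ?thesis
    by (rule that[of u2 u3], rule orthonormal_vec3) (use u2 u3 in \<open>simp_all add: unit3_def\<close>)
qed

text \<open>Choose \<open>a\<close> orthogonal to \<open>x\<close> and \<open>y\<close>, then
  \<open>b\<close> orthogonal to \<open>a\<close> and \<open>x\<close>. Both orders are provided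
  because \<open>a\<close> is needed in first or in second position.\<close>

lemma flag_frame:
  obtains a b c where "orthonormal (vec3 a b c)" "cinner a x = 0" "cinner a y = 0" "cinner b x = 0"
     "cinner a a = 1" "cinner b b = 1" "cinner c c = 1"
     "orthonormal (vec3 b a c)"
proof -
  obtain a where a: "cinner a a = 1" "cinner a x = 0" "cinner a y = 0"
    by (rule unit_orthogonal)
  obtain b where b: "cinner b b = 1" "cinner b a = 0" "cinner b x = 0"
    by (rule unit_orthogonal)
  obtain c where c: "cinner c c = 1" "cinner c a = 0" "cinner c b = 0" "cinner a c = 0" "cinner b c = 0" "cinner a b = 0"
    using orthonormal_frame[OF b(1) a(1) b(2)] by metis
  show ?thesis
    by (rule that[of a b c], rule orthonormal_vec3) (use a b c in \<open>simp_all add: orthonormal_vec3\<close>)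
qed

lemma contract_unit3 [simp]:
  "contract x (unit3 j) z t = cinner x (\<lambda>a. cinner z (t a j))"
  by (simp add: contract_def)

lemma contract_unit3_third: "contract x y (unit3 k) t = cinner y (\<lambda>b. cinner x (\<lambda>a. t a b k))"
  by (simp add: contract_second)

lemma cinner_swap: "cinner x (\<lambda>a. cinner z (\<lambda>c. s a c)) = cinner z (\<lambda>c. cinner x (\<lambda>a. s a c))"
  unfolding cinner_def sum_3 by (simp add: algebra_simps)

section \<open>The seven inequalities for a tensor with diagonal marginals\<close>

context
  fixes t p q r
  assumes D: "diag_marginals t p q r" and p: "chamber 1 p" and q: "chamber 1 q" and r: "chamber 1 r"
begin

lemma sorted_spectra: "p 1 \<le> p 2" "p 2 \<le> p 3" "q 1 \<le> q 2" "q 2 \<le> q 3" "r 1 \<le> r 2" "r 2 \<le> r 3"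
  "p 1 + p 2 + p 3 = 1" "q 1 + q 2 + q 3 = 1" "r 1 + r 2 + r 3 = 1"
  using p q r by (simp_all add: chamber_def)

lemmas occupation_p = occupation_bounds[OF _ sorted_spectra(1,2)]
lemmas occupation_q = occupation_bounds[OF _ sorted_spectra(3,4)]
lemmas occupation_r = occupation_bounds[OF _ sorted_spectra(5,6)]

text \<open>As in the next six lemmas, the weights are the coefficients of the inequality, and the
  bases are chosen to kill every \<open>(i, j, k)\<close> with \<open>f i > g j + h k\<close>. Here
  these are \<open>(1, 3, 3)\<close> and \<open>(2, 3, 3)\<close>.\<close>

lemma slack1_nonneg: "0 \<le> slack1 p q r"
proof -
  obtain u1 u2 u3 where u: "orthonormal (vec3 u1 u2 u3)" "cinner u1 (\<lambda>a. t a 3 3) = 0" "cinner u2 (\<lambda>a. t a 3 3) = 0"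
    "cinner u3 u3 = 1"
    by (rule flag_frame[of "\<lambda>a. t a 3 3"])
  have "(\<Sum>i\<in>UNIV. vec3 1 1 0 i * occupation p (vec3 u1 u2 u3 i)) \<le>
    (\<Sum>i\<in>UNIV. vec3 1 1 0 i * occupation q (unit3 i)) + (\<Sum>i\<in>UNIV. vec3 1 1 0 i * occupation r (unit3 i))"
    by (rule frame_inequality[OF D u(1) orthonormal_unit3 orthonormal_unit3])
      (simp add: forall_3 u)
  then show ?thesis
    using occupation_sum[OF u(1), of p] occupation_p[OF u(4)] sorted_spectra by (simp add: sum_3 slack1_def)
qed

text \<open>The triples to kill are \<open>(1, 3, 2)\<close>, by the choice of \<open>u1\<close>,
  and \<open>(3, 3, 2)\<close>, by that of \<open>w2\<close>. Orthogonality of \<open>w2\<close> to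
  \<open>unit3 1\<close> bounds its occupation below by \<open>r 2\<close>.\<close>

lemma slack2_nonneg: "0 \<le> slack2 p q r"
proof -
  obtain w2 w1 w3 where w: "orthonormal (vec3 w1 w2 w3)" "cinner w2 (unit3 1) = 0" "cinner w2 (t 3 3) = 0" "cinner w2 w2 = 1"
    by (rule flag_frame[of "unit3 1" "t 3 3"])
  obtain u1 u2 where u: "orthonormal (vec3 u1 u2 (unit3 3))" "cinner u1 (\<lambda>a. cinner w2 (t a 3)) = 0"
    "cinner u2 u2 = 1" "u2 3 = 0"
    by (rule last_fixed_frame)
  have "(\<Sum>i\<in>UNIV. vec3 1 0 1 i * occupation p (vec3 u1 u2 (unit3 3) i)) \<le>
    (\<Sum>i\<in>UNIV. vec3 1 1 0 i * occupation q (unit3 i)) + (\<Sum>i\<in>UNIV. vec3 1 0 1 i * occupation r (vec3 w1 w2 w3 i))"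
    by (rule frame_inequality[OF D u(1) orthonormal_unit3 w(1)])
      (use u w in \<open>simp add: forall_3\<close>)
  then show ?thesis
    using occupation_sum[OF u(1), of p] occupation_sum[OF w(1), of r] occupation_p(4)[OF u(3,4)] occupation_r(3)[OF w(4)] w(2)
      sorted_spectra by (simp add: sum_3 slack2_def)
qed

text \<open>The triples to kill are \<open>(2, 3, 1)\<close> and \<open>(3, 3, 1)\<close>, both by
  the choice of \<open>w1\<close>.\<close>

lemma slack3_nonneg: "0 \<le> slack3 p q r"
proof -
  obtain w1 w2 w3 where w: "orthonormal (vec3 w1 w2 w3)" "cinner w1 (t 2 3) = 0" "cinner w1 (t 3 3) = 0" "cinner w1 w1 = 1"
    by (rule flag_frame[of "t 2 3" "t 3 3"])
  have "(\<Sum>i\<in>UNIV. vec3 0 1 1 i * occupation p (unit3 i)) \<le>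
    (\<Sum>i\<in>UNIV. vec3 1 1 0 i * occupation q (unit3 i)) + (\<Sum>i\<in>UNIV. vec3 0 1 1 i * occupation r (vec3 w1 w2 w3 i))"
    by (rule frame_inequality[OF D orthonormal_unit3 orthonormal_unit3 w(1)])
      (use w in \<open>simp add: forall_3\<close>)
  then show ?thesis
    using occupation_sum[OF w(1), of r] occupation_r(1)[OF w(4)] sorted_spectra by (simp add: sum_3 slack3_def)
qed

text \<open>The triples to kill are \<open>(1, 3, 3)\<close> and \<open>(2, 3, 3)\<close>, by
  \<open>u1\<close> and \<open>u2\<close>, then \<open>(2, 1, 3)\<close> by \<open>v1\<close> and
  \<open>(2, 3, 1)\<close> by \<open>w1\<close>.\<close>

lemma slack4_nonneg: "0 \<le> slack4 p q r"
proof -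
  obtain u2 where u2: "cinner u2 u2 = 1" "cinner u2 (unit3 1) = 0" "cinner u2 (\<lambda>a. t a 3 3) = 0"
    by (rule unit_orthogonal)
  obtain u1 where u1: "cinner u1 u1 = 1" "cinner u1 u2 = 0" "cinner u1 (\<lambda>a. t a 3 3) = 0"
    by (rule unit_orthogonal)
  obtain u3 where u3: "cinner u3 u3 = 1" "cinner u1 u3 = 0" "cinner u2 u3 = 0"
    using orthonormal_frame[OF u1(1) u2(1) u1(2)] by metis
  have u: "orthonormal (vec3 u1 u2 u3)" by (rule orthonormal_vec3) fact+
  obtain v1 v2 where v: "orthonormal (vec3 v1 v2 (unit3 3))" "cinner v1 (\<lambda>b. cinner u2 (\<lambda>a. t a b 3)) = 0"
    "cinner v2 v2 = 1" "v2 3 = 0"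
    by (rule last_fixed_frame)
  obtain w1 w2 where w: "orthonormal (vec3 w1 w2 (unit3 3))" "cinner w1 (\<lambda>c. cinner u2 (\<lambda>a. t a 3 c)) = 0"
    "cinner w2 w2 = 1" "w2 3 = 0"
    by (rule last_fixed_frame)
  have "(\<Sum>i\<in>UNIV. vec3 1 2 0 i * occupation p (vec3 u1 u2 u3 i)) \<le>
    (\<Sum>i\<in>UNIV. vec3 1 2 0 i * occupation q (vec3 v1 v2 (unit3 3) i))
    + (\<Sum>i\<in>UNIV. vec3 1 2 0 i * occupation r (vec3 w1 w2 (unit3 3) i))"
    by (rule frame_inequality[OF D u v(1) w(1)])
      (use u1 u2 v w in \<open>simp add: forall_3 contract_unit3_third cinner_swap[of _ w1]\<close>)
  then show ?thesis
    using occupation_sum[OF u, of p] occupation_sum[OF v(1), of q] occupation_sum[OF w(1), of r]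
      occupation_p(2)[OF u3(1)] occupation_p(3)[OF u2(1)] u2(2) occupation_q(4)[OF v(3,4)] occupation_r(4)[OF w(3,4)]
      sorted_spectra by (simp add: sum_3 slack4_def)
qed

text \<open>The triples to kill are \<open>(1, 3, 3)\<close>, \<open>(1, 3, 2)\<close> and
  \<open>(2, 3, 3)\<close>, by the flag, and \<open>(1, 1, 3)\<close>, by \<open>v1\<close>.\<close>

lemma slack5_nonneg: "0 \<le> slack5 p q r"
proof -
  obtain u1 u2 u3 where u: "orthonormal (vec3 u1 u2 u3)" "cinner u1 (\<lambda>a. t a 3 3) = 0" "cinner u1 (\<lambda>a. t a 3 2) = 0"
    "cinner u2 (\<lambda>a. t a 3 3) = 0" "cinner u1 u1 = 1" "cinner u3 u3 = 1"
    by (rule flag_frame[of "\<lambda>a. t a 3 3" "\<lambda>a. t a 3 2"])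
  obtain v1 v2 where v: "orthonormal (vec3 v1 v2 (unit3 3))" "cinner v1 (\<lambda>b. cinner u1 (\<lambda>a. t a b 3)) = 0"
    "cinner v2 v2 = 1" "v2 3 = 0"
    by (rule last_fixed_frame)
  have "(\<Sum>i\<in>UNIV. vec3 2 1 0 i * occupation p (vec3 u1 u2 u3 i)) \<le>
    (\<Sum>i\<in>UNIV. vec3 1 2 0 i * occupation q (vec3 v1 v2 (unit3 3) i))
    + (\<Sum>i\<in>UNIV. vec3 2 1 0 i * occupation r (unit3 i))"
    by (rule frame_inequality[OF D u(1) v(1) orthonormal_unit3])
      (use u v in \<open>simp add: forall_3 contract_unit3_third\<close>)
  then show ?thesis
    using occupation_sum[OF u(1), of p] occupation_sum[OF v(1), of q]
      occupation_p(1)[OF u(5)] occupation_p(2)[OF u(6)] occupation_q(4)[OF v(3,4)] sorted_spectra by (simp add: sum_3 slack5_def)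
qed

text \<open>The triples to kill are \<open>(2, 3, 1)\<close> and \<open>(3, 3, 1)\<close>, by
  \<open>w1\<close>, then \<open>(2, 3, 3)\<close> by \<open>u2\<close> and \<open>(2, 1, 1)\<close>
  by \<open>v1\<close>.\<close>

lemma slack6_nonneg: "0 \<le> slack6 p q r"
proof -
  obtain w1 where w1: "cinner w1 w1 = 1" "cinner w1 (t 2 3) = 0" "cinner w1 (t 3 3) = 0"
    by (rule unit_orthogonal)
  obtain w2 where w2: "cinner w2 w2 = 1" "cinner w2 w1 = 0" "cinner w2 (unit3 3) = 0"
    by (rule unit_orthogonal)
  obtain w3 where w3: "cinner w3 w3 = 1" "cinner w2 w3 = 0" "cinner w1 w3 = 0" "cinner w1 w2 = 0"
    using orthonormal_frame[OF w2(1) w1(1) w2(2)] by metis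
  have w: "orthonormal (vec3 w1 w2 w3)" by (rule orthonormal_vec3) fact+
  obtain u2 u3 where u: "orthonormal (vec3 (unit3 1) u2 u3)" "cinner u2 (\<lambda>a. cinner w3 (t a 3)) = 0"
    "cinner u2 u2 = 1" "u2 1 = 0" "u3 1 = 0"
    by (rule first_fixed_frame)
  obtain v1 v2 where v: "orthonormal (vec3 v1 v2 (unit3 3))" "cinner v1 (\<lambda>b. cinner u2 (\<lambda>a. cinner w1 (t a b))) = 0"
    "cinner v2 v2 = 1" "v2 3 = 0"
    by (rule last_fixed_frame)
  have z: "cinner x (\<lambda>a. cinner w1 (t a 3)) = 0" if "x 1 = 0" for x
    using that w1 by (simp add: cinner_def[of x] sum_3)
  have "(\<Sum>i\<in>UNIV. vec3 0 2 1 i * occupation p (vec3 (unit3 1) u2 u3 i)) \<le>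
    (\<Sum>i\<in>UNIV. vec3 1 2 0 i * occupation q (vec3 v1 v2 (unit3 3) i))
    + (\<Sum>i\<in>UNIV. vec3 0 2 1 i * occupation r (vec3 w1 w2 w3 i))"
    by (rule frame_inequality[OF D u(1) v(1) w])
      (use u v z in \<open>simp add: forall_3 contract_second[of u2 v1]\<close>)
  then show ?thesis
    using occupation_sum[OF u(1), of p] occupation_sum[OF v(1), of q] occupation_sum[OF w, of r]
      occupation_p(3)[OF u(3,4)] occupation_q(4)[OF v(3,4)] occupation_r(1)[OF w1(1)] occupation_r(4)[OF w2(1)] w2(3)
      sorted_spectra by (simp add: sum_3 slack6_def)
qed

text \<open>The triples to kill are \<open>(2, 3, 1)\<close> and \<open>(3, 3, 1)\<close>, by
  \<open>w1\<close>, then \<open>(2, 2, 1)\<close> by \<open>u2\<close> and \<open>(2, 3, 2)\<close>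
  by \<open>w2\<close>.\<close>

lemma slack7_nonneg: "0 \<le> slack7 p q r"
proof -
  obtain w1 where w1: "cinner w1 w1 = 1" "cinner w1 (t 2 3) = 0" "cinner w1 (t 3 3) = 0"
    by (rule unit_orthogonal)
  obtain u2 u3 where u: "orthonormal (vec3 (unit3 1) u2 u3)" "cinner u2 (\<lambda>a. cinner w1 (t a 2)) = 0"
    "cinner u2 u2 = 1" "u2 1 = 0" "u3 1 = 0"
    by (rule first_fixed_frame)
  obtain w2 where w2: "cinner w2 w2 = 1" "cinner w2 w1 = 0" "cinner w2 (\<lambda>c. cinner u2 (\<lambda>a. t a 3 c)) = 0"
    by (rule unit_orthogonal)
  obtain w3 where w3: "cinner w3 w3 = 1" "cinner w2 w3 = 0" "cinner w1 w3 = 0" "cinner w1 w2 = 0"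
    using orthonormal_frame[OF w2(1) w1(1) w2(2)] by metis
  have w: "orthonormal (vec3 w1 w2 w3)" by (rule orthonormal_vec3) fact+
  have z: "cinner x (\<lambda>a. cinner w1 (t a 3)) = 0" if "x 1 = 0" for x
    using that w1 by (simp add: cinner_def[of x] sum_3)
  have "(\<Sum>i\<in>UNIV. vec3 0 2 1 i * occupation p (vec3 (unit3 1) u2 u3 i)) \<le>
    (\<Sum>i\<in>UNIV. vec3 2 1 0 i * occupation q (unit3 i)) + (\<Sum>i\<in>UNIV. vec3 0 1 2 i * occupation r (vec3 w1 w2 w3 i))"
    by (rule frame_inequality[OF D u(1) orthonormal_unit3 w])
      (use u w2 z in \<open>simp add: forall_3 cinner_swap[of _ w2]\<close>)
  then show ?thesis
    using occupation_sum[OF u(1), of p] occupation_sum[OF w, of r]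
      occupation_p(3)[OF u(3,4)] occupation_r(1)[OF w1(1)] occupation_r(2)[OF w3(1)]
      sorted_spectra by (simp add: sum_3 slack7_def)
qed

lemma slacks_nonneg: "g \<in> slacks \<Longrightarrow> 0 \<le> g p q r"
  unfolding slacks_def
  using slack1_nonneg slack2_nonneg slack3_nonneg slack4_nonneg slack5_nonneg slack6_nonneg slack7_nonneg by auto

end

lemma diag_marginals_swap:
  assumes "diag_marginals t p q r"
  shows "diag_marginals (swap12 t) q p r" "diag_marginals (swap13 t) r q p"
proof -
  have "marginal1 (swap13 (swap12 t)) i i' = marginal1 (swap13 t) i i'"
    "marginal1 (swap12 (swap13 t)) i i' = marginal1 (swap12 t) i i'" for i i'
    unfolding marginal1_def swap12_def swap13_def by (rule sum.swap)+
  then show "diag_marginals (swap12 t) q p r" "diag_marginals (swap13 t) r q p"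
    using assms by (simp_all add: diag_marginals_def)
qed

lemma polytope_of_diag_marginals:
  assumes "diag_marginals t p q r" "chamber 1 p" "chamber 1 q" "chamber 1 r"
  shows "polytope3 1 p q r"
proof -
  note s = diag_marginals_swap
  have "0 \<le> g p q r" "0 \<le> g p r q" "0 \<le> g q p r" "0 \<le> g q r p" "0 \<le> g r p q" "0 \<le> g r q p" if "g \<in> slacks" for g
    using slacks_nonneg[OF assms that] slacks_nonneg[OF s(2)[OF s(1)[OF s(2)[OF assms(1)]]] assms(2,4,3) that]
      slacks_nonneg[OF s(1)[OF assms(1)] assms(3,2,4) that] slacks_nonneg[OF s(1)[OF s(2)[OF assms(1)]] assms(3,4,2) that]
      slacks_nonneg[OF s(2)[OF s(1)[OF assms(1)]] assms(4,2,3) that] slacks_nonneg[OF s(2)[OF assms(1)] assms(4,3,2) that]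
    by blast+
  then show ?thesis using assms by (auto simp: polytope3_def perm_slacks_def)
qed

section \<open>Spectra of reduced density matrices\<close>

definition apply_mat :: "(3 \<Rightarrow> 3 \<Rightarrow> complex) \<Rightarrow> (3 \<Rightarrow> complex) \<Rightarrow> 3 \<Rightarrow> complex" where
  "apply_mat M x m = (\<Sum>m'\<in>UNIV. M m m' * x m')"

lemma orthonormal_expand:
  assumes "orthonormal u"
  shows "x = (\<lambda>m. \<Sum>i\<in>UNIV. cinner (u i) x * u i m)"
proof
  fix m
  have "(\<Sum>i\<in>UNIV. cinner (u i) x * u i m) = (\<Sum>n\<in>UNIV. x n * (\<Sum>i\<in>UNIV. u i m * cnj (u i n)))"
    unfolding cinner_def sum_3 by (simp add: algebra_simps)
  also have "\<dots> = x m" unfolding orthonormalD[OF assms] by (simp add: if_distrib cong: if_cong)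
  finally show "x m = (\<Sum>i\<in>UNIV. cinner (u i) x * u i m)" by simp
qed

lemma cinner_linear:
  "cinner x (\<lambda>m. a * y m + b * z m) = a * cinner x y + b * cinner x z"
  "cinner x (\<lambda>m. a * y m) = a * cinner x y"
  unfolding cinner_def sum_3 by (simp_all add: algebra_simps)

lemma apply_mat_linear:
  "apply_mat M (\<lambda>m. a * y m + b * z m) = (\<lambda>m. a * apply_mat M y m + b * apply_mat M z m)"
  "apply_mat M (\<lambda>m. a * y m) = (\<lambda>m. a * apply_mat M y m)"
  unfolding apply_mat_def sum_3 by (simp_all add: algebra_simps)

lemma cinner_apply_mat:
  assumes "\<And>i j. M i j = cnj (M j i)"
  shows "cinner x (apply_mat M y) = cnj (cinner y (apply_mat M x))"
  unfolding cinner_def apply_mat_def sum_3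
  using assms[of 1 1] assms[of 1 2] assms[of 1 3] assms[of 2 2] assms[of 2 3] assms[of 3 3]
  by (simp add: algebra_simps)

text \<open>
  The vectors \<open>x1, x2, x3\<close> form a basis in which \<open>M\<close> is triangular, and \<open>y1, y2, y3\<close> is its dual
  basis. An orthonormal basis adapted to the flag of the \<open>x\<close> keeps \<open>M\<close> triangular, hence
  diagonal because \<open>M\<close> is Hermitian.
\<close>

lemma hermitian_diagonalization:
  assumes herm: "\<And>i j. M i j = cnj (M j i)"
    and p1: "apply_mat M x1 = (\<lambda>m. l1 * x1 m)"
    and p2: "apply_mat M x2 = (\<lambda>m. b12 * x1 m + l2 * x2 m)"
    and p3: "apply_mat M x3 = (\<lambda>m. b13 * x1 m + (b23 * x2 m + l3 * x3 m))"
    and dual: "cinner y1 x1 = 1" "cinner y2 x1 = 0" "cinner y2 x2 = 1"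
      "cinner y3 x1 = 0" "cinner y3 x2 = 0" "cinner y3 x3 = 1"
  shows "\<exists>u. orthonormal u \<and> (\<forall>i j. cinner (u i) (apply_mat M (u j)) = (if i = j then vec3 l1 l2 l3 i else 0))"
proof -
  \<comment> \<open>Gram-Schmidt from the end of the flag: \<open>u1\<close> becomes a multiple of
    \<open>x1\<close>, and \<open>u2\<close> lies in the span of \<open>x1\<close> and
    \<open>x2\<close>.\<close>
  obtain u3 where u3: "cinner u3 u3 = 1" "cinner u3 x1 = 0" "cinner u3 x2 = 0"
    by (rule unit_orthogonal)
  obtain u2 where u2: "cinner u2 u2 = 1" "cinner u2 x1 = 0" "cinner u2 u3 = 0"
    by (rule unit_orthogonal)
  obtain u1 where u1: "cinner u1 u1 = 1" "cinner u1 u2 = 0" "cinner u1 u3 = 0"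
    using orthonormal_frame[OF u2(1) u3(1) u2(3)] by metis
  define u where "u = vec3 u1 u2 u3"
  have u: "orthonormal u" unfolding u_def by (rule orthonormal_vec3) fact+
  have u_perp: "cinner u2 u1 = 0" "cinner u3 u1 = 0" "cinner u3 u2 = 0"
    using u1 u2 cinner_eq_0_commute by blast+
  define a where "a = cinner u1 x1"
  define b c where bc: "b = cinner u1 x2" "c = cinner u2 x2"
  define d e f where def: "d = cinner u1 x3" "e = cinner u2 x3" "f = cinner u3 x3"
  have x1: "x1 = (\<lambda>m. a * u1 m)"
    by (subst orthonormal_expand[OF u, of x1]) (simp add: u_def sum_3 a_def u2 u3)
  have x2: "x2 = (\<lambda>m. b * u1 m + c * u2 m)"
    by (subst orthonormal_expand[OF u, of x2]) (simp add: u_def sum_3 bc u2 u3)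
  have x3: "x3 = (\<lambda>m. d * u1 m + 1 * (\<lambda>m. e * u2 m + f * u3 m) m)"
    by (subst orthonormal_expand[OF u, of x3]) (simp add: u_def sum_3 def add.assoc)
  \<comment> \<open>The dual basis makes the diagonal coefficients \<open>a\<close>,
    \<open>c\<close>, \<open>f\<close> of the triangular change of basis nonzero.\<close>
  have "a \<noteq> 0" using dual(1) x1 by (auto simp: cinner_def)
  then have "cinner y2 u1 = 0" "cinner y3 u1 = 0" using dual(2,4) unfolding x1 cinner_linear by auto
  have "c \<noteq> 0" using dual(3) \<open>cinner y2 u1 = 0\<close> unfolding x2 cinner_linear by auto
  then have "cinner y3 u2 = 0" using dual(5) \<open>cinner y3 u1 = 0\<close> unfolding x2 cinner_linear by auto
  have "f \<noteq> 0" using dual(6) \<open>cinner y3 u1 = 0\<close> \<open>cinner y3 u2 = 0\<close> unfolding x3 cinner_linear by auto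
  have m1: "cinner y (apply_mat M u1) = l1 * cinner y u1" for y
  proof -
    have "a * cinner y (apply_mat M u1) = cinner y (apply_mat M x1)"
      unfolding x1 apply_mat_linear cinner_linear ..
    also have "\<dots> = a * (l1 * cinner y u1)" unfolding p1 unfolding x1 cinner_linear by (simp add: mult_ac)
    finally show ?thesis using \<open>a \<noteq> 0\<close> by simp
  qed
  have m2: "cinner y (apply_mat M u2) = l2 * cinner y u2" if "cinner y u1 = 0" for y
  proof -
    have "b * cinner y (apply_mat M u1) + c * cinner y (apply_mat M u2) = cinner y (apply_mat M x2)"
      unfolding x2 apply_mat_linear cinner_linear ..
    also have "\<dots> = c * (l2 * cinner y u2)"
      unfolding p2 cinner_linear unfolding x1 x2 cinner_linear using that by (simp add: mult_ac)
    finally show ?thesis using \<open>c \<noteq> 0\<close> that by (simp add: m1)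
  qed
  have m3: "cinner u3 (apply_mat M u3) = l3"
  proof -
    have "f * cinner u3 (apply_mat M u3) = cinner u3 (apply_mat M x3)"
      unfolding x3 apply_mat_linear cinner_linear using u_perp by (simp add: m1 m2)
    also have "\<dots> = b13 * cinner u3 x1 + b23 * cinner u3 x2 + l3 * cinner u3 x3"
      unfolding p3 by (simp add: cinner_def sum_3 algebra_simps)
    also have "\<dots> = f * l3" using u3 by (simp add: def)
    finally show ?thesis using \<open>f \<noteq> 0\<close> by simp
  qed
  have "cinner u2 (apply_mat M u1) = 0" "cinner u3 (apply_mat M u1) = 0" "cinner u3 (apply_mat M u2) = 0"
    using u_perp by (simp_all add: m1 m2)
  moreover from this have "cinner u1 (apply_mat M u2) = 0" "cinner u1 (apply_mat M u3) = 0" "cinner u2 (apply_mat M u3) = 0"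
    using cinner_apply_mat[OF herm, where x = u1 and y = u2]
      cinner_apply_mat[OF herm, where x = u1 and y = u3]
      cinner_apply_mat[OF herm, where x = u2 and y = u3] by simp_all
  ultimately have "\<forall>i j. cinner (u i) (apply_mat M (u j)) = (if i = j then vec3 l1 l2 l3 i else 0)"
    unfolding forall_3 u_def using u1 u2 u_perp m3 by (simp add: m1 m2)
  with u show ?thesis by blast
qed

section \<open>Translation between matrix indices and the index type\<close>

lemma sum_lessThan_3: "(\<Sum>i<3. f i) = f 0 + f 1 + f (2::nat)"
  by (simp add: numeral_3_eq_3 numeral_2_eq_2)

definition index :: "3 \<Rightarrow> nat" where "index = vec3 0 1 2"
definition coindex :: "nat \<Rightarrow> 3" where "coindex n = (if n = 0 then 1 else if n = 1 then 2 else 3)"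

lemma index_simps [simp]: "index 1 = 0" "index 2 = 1" "index 3 = 2" "coindex 0 = 1" "coindex 1 = 2" "coindex (Suc 0) = 2" "coindex 2 = 3"
  "coindex (index i) = i" "index i < 3"
  using exhaust_3[of i] by (auto simp: index_def coindex_def)

definition tensor_of :: "(nat \<Rightarrow> nat \<Rightarrow> nat \<Rightarrow> complex) \<Rightarrow> tensor" where
  "tensor_of c i j k = c (index i) (index j) (index k)"

lemma reduced_density_entries:
  assumes "i < 3" "j < 3"
  shows "reduced_density 1 c $$ (i, j) = marginal1 (tensor_of c) (coindex i) (coindex j)"
    "reduced_density 2 c $$ (i, j) = marginal1 (swap12 (tensor_of c)) (coindex i) (coindex j)"
    "reduced_density 3 c $$ (i, j) = marginal1 (swap13 (tensor_of c)) (coindex i) (coindex j)"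
proof -
  have sum: "(\<Sum>n<3. f n) = (\<Sum>i\<in>UNIV. f (index i))" for f :: "nat \<Rightarrow> complex"
    by (simp add: sum_3 sum_lessThan_3)
  have inv: "index (coindex i) = i" "index (coindex j) = j"
    using assms by (auto simp: coindex_def)
  show "reduced_density 1 c $$ (i, j) = marginal1 (tensor_of c) (coindex i) (coindex j)"
    "reduced_density 2 c $$ (i, j) = marginal1 (swap12 (tensor_of c)) (coindex i) (coindex j)"
    using assms unfolding reduced_density_def marginal1_def tensor_of_def swap12_def sum inv by simp_all
  have "reduced_density 3 c $$ (i, j) = (\<Sum>a\<in>UNIV. \<Sum>b\<in>UNIV. c (index a) (index b) i * cnj (c (index a) (index b) j))"
    using assms unfolding reduced_density_def sum by simp
  also have "\<dots> = marginal1 (swap13 (tensor_of c)) (coindex i) (coindex j)"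
    unfolding marginal1_def tensor_of_def swap13_def inv by (rule sum.swap)
  finally show "reduced_density 3 c $$ (i, j) = marginal1 (swap13 (tensor_of c)) (coindex i) (coindex j)" .
qed

lemma reduced_density_eq:
  "reduced_density 1 c = Matrix.mat 3 3 (\<lambda>(i, j). marginal1 (tensor_of c) (coindex i) (coindex j))"
  "reduced_density 2 c = Matrix.mat 3 3 (\<lambda>(i, j). marginal1 (swap12 (tensor_of c)) (coindex i) (coindex j))"
  "reduced_density 3 c = Matrix.mat 3 3 (\<lambda>(i, j). marginal1 (swap13 (tensor_of c)) (coindex i) (coindex j))"
proof -
  have "dim_row (reduced_density a c) = 3" "dim_col (reduced_density a c) = 3" for a
    by (simp_all add: reduced_density_def)
  then show "reduced_density 1 c = Matrix.mat 3 3 (\<lambda>(i, j). marginal1 (tensor_of c) (coindex i) (coindex j))"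
    "reduced_density 2 c = Matrix.mat 3 3 (\<lambda>(i, j). marginal1 (swap12 (tensor_of c)) (coindex i) (coindex j))"
    "reduced_density 3 c = Matrix.mat 3 3 (\<lambda>(i, j). marginal1 (swap13 (tensor_of c)) (coindex i) (coindex j))"
    by (intro eq_matI; simp only: reduced_density_entries dim_row_mat dim_col_mat index_mat prod.case)+
qed

lemma upt_3: "[0..<3] = [0, 1, 2::nat]"
  by (simp add: numeral_3_eq_3 numeral_2_eq_2)

section \<open>Eigenvalues and diagonalization of the marginals\<close>

lemma proots_linear_factors: "proots (\<Prod>x\<leftarrow>xs. [:- x, 1:]) = mset xs" for xs :: "complex list"
proof (induction xs)
  case (Cons a xs)
  have "(\<Prod>x\<leftarrow>xs. [:- x, 1:]) \<noteq> 0"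
    by (induction xs) (simp_all del: mult_pCons_left)
  then have "proots ([:- a, 1:] * (\<Prod>x\<leftarrow>xs. [:- x, 1:])) = proots [:- a, 1:] + proots (\<Prod>x\<leftarrow>xs. [:- x, 1:])"
    by (intro proots_mult) simp_all
  then show ?case using Cons by (simp del: mult_pCons_left)
qed simp

lemma eigenvalues_mset_diagonal:
  assumes "\<And>i j. M i j = (if i = j then d i else 0)"
  shows "eigenvalues_mset (Matrix.mat 3 3 (\<lambda>(i, j). M (coindex i) (coindex j))) = {#d 1, d 2, d 3#}"
proof -
  let ?A = "Matrix.mat 3 3 (\<lambda>(i, j). M (coindex i) (coindex j))"
  have "upper_triangular ?A"
    by (auto simp: upper_triangular_def assms coindex_def split: if_splits)
  then have "char_poly ?A = (\<Prod>a\<leftarrow>diag_mat ?A. [:- a, 1:])"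
    by (intro char_poly_upper_triangular[of _ 3]) auto
  also have "diag_mat ?A = [d 1, d 2, d 3]"
    by (simp add: diag_mat_def upt_3 assms)
  finally show ?thesis
    unfolding eigenvalues_mset_def by (simp only: proots_linear_factors mset.simps)
qed

text \<open>Over the complex numbers the characteristic polynomial is a product of monic linear
  factors, so its roots with multiplicity determine it.\<close>

lemma char_poly_of_eigenvalues_mset:
  assumes A: "A \<in> carrier_mat 3 3" and e: "eigenvalues_mset A = {#a, b, c#}"
  shows "char_poly A = (\<Prod>x\<leftarrow>[a, b, c]. [:- x, 1:])"
proof -
  obtain as where as: "char_poly A = (\<Prod>x\<leftarrow>as. [:- x, 1:])"
    using char_poly_factorized[OF A] by auto
  have "mset as = mset [a, b, c]"
    using e unfolding eigenvalues_mset_def as proots_linear_factors by simp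
  then have "prod_mset (image_mset (\<lambda>x. [:- x, 1:]) (mset as)) = prod_mset (image_mset (\<lambda>x. [:- x, 1:]) (mset [a, b, c]))"
    by simp
  then show ?thesis unfolding as by (simp add: prod_mset_prod_list[symmetric])
qed

text \<open>Schur decomposition with the eigenvalues in the prescribed order supplies the
  triangularizing basis for \<open>hermitian_diagonalization\<close>.\<close>

lemma marginal_diagonalization:
  assumes "eigenvalues_mset (Matrix.mat 3 3 (\<lambda>(i, j). marginal1 t (coindex i) (coindex j))) = {#a, b, c#}"
  shows "\<exists>u. orthonormal u \<and> (\<forall>i i'.
    (\<Sum>m\<in>UNIV. \<Sum>m'\<in>UNIV. cnj (u i m) * u i' m' * marginal1 t m m')
    = (if i = i' then vec3 a b c i else 0))"
proof -
  let ?A = "Matrix.mat 3 3 (\<lambda>(i, j). marginal1 t (coindex i) (coindex j))"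
  have A: "?A \<in> carrier_mat 3 3" by simp
  obtain B P Q where schur: "schur_decomposition ?A [a, b, c] = (B, P, Q)" using prod_cases3 by blast
  have sim: "similar_mat_wit ?A B P Q" and ut: "upper_triangular B" and dg: "diag_mat B = [a, b, c]"
    using schur_decomposition[OF A char_poly_of_eigenvalues_mset[OF A assms] schur] by blast+
  note w = similar_mat_witD2[OF A sim]
  have AP: "?A * P = P * B"
  proof -
    have "?A * P = P * B * (Q * P)" unfolding w(3) using w by (simp add: assoc_mult_mat[of _ 3 3 _ 3 _ 3])
    then show ?thesis using w by simp
  qed
  have mult: "(X * Y) $$ (i, j) = X $$ (i, 0) * Y $$ (0, j) + X $$ (i, 1) * Y $$ (1, j) + X $$ (i, 2) * Y $$ (2, j)"
    if "X \<in> carrier_mat 3 3" "Y \<in> carrier_mat 3 3" "i < 3" "j < 3" for X Y :: "complex mat" and i j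
    using that by (simp add: scalar_prod_def atLeast0LessThan sum_lessThan_3)
  have dim: "dim_row B = 3" using w by simp
  have "[B $$ (0, 0), B $$ (1, 1), B $$ (2, 2)] = [a, b, c]"
    unfolding dg[symmetric] by (simp add: diag_mat_def upt_3 dim)
  moreover have "B $$ (1, 0) = 0" "B $$ (2, 0) = 0" "B $$ (2, 1) = 0"
    by (rule upper_triangularD[OF ut]; simp add: dim)+
  ultimately have B: "B $$ (1, 0) = 0" "B $$ (2, 0) = 0" "B $$ (2, 1) = 0" "B $$ (0, 0) = a" "B $$ (1, 1) = b" "B $$ (2, 2) = c"
    by simp_all
  \<comment> \<open>Columns of \<open>P\<close> and conjugated rows of its inverse \<open>Q\<close>
    form dual bases.\<close>
  define x where "x j m = P $$ (index m, j)" for j m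
  define y where "y j m = cnj (Q $$ (j, index m))" for j m
  have ap: "apply_mat (marginal1 t) (x j) m = x 0 m * B $$ (0, j) + x 1 m * B $$ (1, j) + x 2 m * B $$ (2, j)" if "j < 3" for j m
  proof -
    have "apply_mat (marginal1 t) (x j) m = (?A * P) $$ (index m, j)"
      using that by (simp add: mult[OF A w(6)] apply_mat_def x_def sum_3)
    also have "\<dots> = x 0 m * B $$ (0, j) + x 1 m * B $$ (1, j) + x 2 m * B $$ (2, j)"
      unfolding AP using that by (simp add: mult[OF w(6,5)] x_def)
    finally show ?thesis .
  qed
  have QP: "cinner (y i) (x j) = (if i = j then 1 else 0)" if "i < 3" "j < 3" for i j
  proof -
    have "cinner (y i) (x j) = (Q * P) $$ (i, j)"
      using that by (simp add: mult[OF w(7,6)] cinner_def x_def y_def sum_3)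
    then show ?thesis unfolding w(2) using that by simp
  qed
  have "\<exists>u. orthonormal u \<and> (\<forall>i j. cinner (u i) (apply_mat (marginal1 t) (u j)) = (if i = j then vec3 a b c i else 0))"
    by (rule hermitian_diagonalization[where ?x1.0 = "x 0" and ?x2.0 = "x 1" and ?x3.0 = "x 2"
          and ?y1.0 = "y 0" and ?y2.0 = "y 1" and ?y3.0 = "y 2"
          and ?b12.0 = "B $$ (0, 1)" and ?b13.0 = "B $$ (0, 2)" and ?b23.0 = "B $$ (1, 2)"])
      (rule marginal1_sym, simp_all add: QP ap fun_eq_iff B[simplified] mult_ac)
  moreover have "cinner x (apply_mat (marginal1 t) z) = (\<Sum>m\<in>UNIV. \<Sum>m'\<in>UNIV. cnj (x m) * z m' * marginal1 t m m')" for x z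
    by (simp add: cinner_def apply_mat_def sum_distrib_left mult_ac)
  ultimately show ?thesis by simp
qed

lemma diag_marginals_of_state:
  assumes "eigenvalues_mset (reduced_density 1 \<psi>) = {#complex_of_real (p 1), complex_of_real (p 2), complex_of_real (p 3)#}"
    and "eigenvalues_mset (reduced_density 2 \<psi>) = {#complex_of_real (q 1), complex_of_real (q 2), complex_of_real (q 3)#}"
    and "eigenvalues_mset (reduced_density 3 \<psi>) = {#complex_of_real (r 1), complex_of_real (r 2), complex_of_real (r 3)#}"
  shows "\<exists>t. diag_marginals t p q r"
proof -
  have vec: "vec3 (complex_of_real (p 1)) (complex_of_real (p 2)) (complex_of_real (p 3)) i = complex_of_real (p i)" for p i
    using exhaust_3[of i] by auto
  obtain u where u: "orthonormal u"
      "\<And>i i'. (\<Sum>m\<in>UNIV. \<Sum>m'\<in>UNIV. cnj (u i m) * u i' m' * marginal1 (tensor_of \<psi>) m m')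
       = (if i = i' then of_real (p i) else 0)"
    using marginal_diagonalization[OF assms(1)[unfolded reduced_density_eq]] unfolding vec by blast
  obtain v where v: "orthonormal v"
      "\<And>i i'. (\<Sum>m\<in>UNIV. \<Sum>m'\<in>UNIV. cnj (v i m) * v i' m' * marginal1 (swap12 (tensor_of \<psi>)) m m')
       = (if i = i' then of_real (q i) else 0)"
    using marginal_diagonalization[OF assms(2)[unfolded reduced_density_eq]] unfolding vec by blast
  obtain w where w: "orthonormal w"
      "\<And>i i'. (\<Sum>m\<in>UNIV. \<Sum>m'\<in>UNIV. cnj (w i m) * w i' m' * marginal1 (swap13 (tensor_of \<psi>)) m m')
       = (if i = i' then of_real (r i) else 0)"
    using marginal_diagonalization[OF assms(3)[unfolded reduced_density_eq]] unfolding vec by blast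
  have "diag_marginals (frame u v w (tensor_of \<psi>)) p q r"
    unfolding diag_marginals_def frame_marginals[OF u(1) v(1) w(1)] u(2) v(2) w(2) by simp
  then show ?thesis by blast
qed

lemma state_of_diag_marginals:
  assumes D: "diag_marginals t p q r" and p: "p 1 + p 2 + p 3 = 1"
  obtains \<psi> where "three_qutrit_state \<psi>"
    "eigenvalues_mset (reduced_density 1 \<psi>) = {#complex_of_real (p 1), complex_of_real (p 2), complex_of_real (p 3)#}"
    "eigenvalues_mset (reduced_density 2 \<psi>) = {#complex_of_real (q 1), complex_of_real (q 2), complex_of_real (q 3)#}"
    "eigenvalues_mset (reduced_density 3 \<psi>) = {#complex_of_real (r 1), complex_of_real (r 2), complex_of_real (r 3)#}"
proof -
  define \<psi> where "\<psi> i j k = t (coindex i) (coindex j) (coindex k)" for i j k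
  have t: "tensor_of \<psi> = t" by (simp add: fun_eq_iff tensor_of_def \<psi>_def)
  \<comment> \<open>The squared norm is the trace of the first marginal.\<close>
  have "sq_norm t = 1" using D p by (simp add: sq_norm_fibres diag_marginals_def sum_3)
  moreover have "(\<Sum>i<3. \<Sum>j<3. \<Sum>k<3. (cmod (\<psi> i j k))\<^sup>2) = sq_norm t"
    unfolding sum_lessThan_3 sq_norm_def sum_3 by (simp add: \<psi>_def)
  ultimately have "three_qutrit_state \<psi>" by (simp add: three_qutrit_state_def)
  moreover have "eigenvalues_mset (reduced_density 1 \<psi>) = {#complex_of_real (p 1), complex_of_real (p 2), complex_of_real (p 3)#}"
    unfolding reduced_density_eq t by (rule eigenvalues_mset_diagonal) (use D in \<open>simp add: diag_marginals_def\<close>)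
  moreover have "eigenvalues_mset (reduced_density 2 \<psi>) = {#complex_of_real (q 1), complex_of_real (q 2), complex_of_real (q 3)#}"
    unfolding reduced_density_eq t by (rule eigenvalues_mset_diagonal) (use D in \<open>simp add: diag_marginals_def\<close>)
  moreover have "eigenvalues_mset (reduced_density 3 \<psi>) = {#complex_of_real (r 1), complex_of_real (r 2), complex_of_real (r 3)#}"
    unfolding reduced_density_eq t by (rule eigenvalues_mset_diagonal) (use D in \<open>simp add: diag_marginals_def\<close>)
  ultimately show ?thesis using that by blast
qed

lemma triple_permutation:
  fixes a b c :: nat
  assumes "{a, b, c} = {1, 2, 3}"
  shows "(a, b, c) \<in> {(1, 2, 3), (1, 3, 2), (2, 1, 3), (2, 3, 1), (3, 1, 2), (3, 2, 1)}"
proof -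
  have "a \<in> {1, 2, 3}" "b \<in> {1, 2, 3}" "c \<in> {1, 2, 3}"
    unfolding assms[symmetric] by simp_all
  then have "a = 1 \<or> a = 2 \<or> a = 3" "b = 1 \<or> b = 2 \<or> b = 3" "c = 1 \<or> c = 2 \<or> c = 3"
    by (simp_all only: insert_iff empty_iff simp_thms)
  moreover have "card {a, b, c} = 3"
    by (simp add: assms)
  then have "a \<noteq> b" "a \<noteq> c" "b \<noteq> c"
    by (auto simp: card_insert_if split: if_splits)
  ultimately show ?thesis
    by (elim disjE) simp_all
qed

theorem theorem1:
  fixes lam :: "nat \<Rightarrow> nat \<Rightarrow> real"
    \<comment> \<open>\<open>lam a i\<close> is the \<open>i\<close>-th prescribed eigenvalue for particle \<open>a\<close>, with \<open>a\<close>, \<open>i\<close> in \<open>{1, 2, 3}\<close>\<close>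
  assumes nonneg: "\<And>a i. a \<in> {1, 2, 3} \<Longrightarrow> i \<in> {1, 2, 3} \<Longrightarrow> 0 \<le> lam a i"
    and ordered: "\<And>a. a \<in> {1, 2, 3} \<Longrightarrow> lam a 1 \<le> lam a 2 \<and> lam a 2 \<le> lam a 3"
    and normalized: "\<And>a. a \<in> {1, 2, 3} \<Longrightarrow> lam a 1 + lam a 2 + lam a 3 = 1"
  shows
    "(\<exists>\<psi>. three_qutrit_state \<psi> \<and>
        (\<forall>a\<in>{1, 2, 3}. eigenvalues_mset (reduced_density a \<psi>) =
           {#complex_of_real (lam a 1), complex_of_real (lam a 2), complex_of_real (lam a 3)#}))
     \<longleftrightarrow>
     (\<forall>a b c :: nat. {a, b, c} = {1, 2, 3} \<longrightarrow>
        lam a 2 + lam a 1 \<le> lam b 2 + lam b 1 + lam c 2 + lam c 1 \<and>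
        lam a 3 + lam a 1 \<le> lam b 2 + lam b 1 + lam c 3 + lam c 1 \<and>
        lam a 2 + lam a 3 \<le> lam b 2 + lam b 1 + lam c 2 + lam c 3 \<and>
        2 * lam a 2 + lam a 1 \<le> 2 * lam b 2 + lam b 1 + 2 * lam c 2 + lam c 1 \<and>
        2 * lam a 1 + lam a 2 \<le> 2 * lam b 2 + lam b 1 + 2 * lam c 1 + lam c 2 \<and>
        2 * lam a 2 + lam a 3 \<le> 2 * lam b 2 + lam b 1 + 2 * lam c 2 + lam c 3 \<and>
        2 * lam a 2 + lam a 3 \<le> 2 * lam b 1 + lam b 2 + 2 * lam c 3 + lam c 2)"
    (is "?states \<longleftrightarrow> (\<forall>a b c. {a, b, c} = {1, 2, 3} \<longrightarrow> ?ineqs a b c)")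
proof -
  define s where "s a = vec3 (lam a 1) (lam a 2) (lam a 3)" for a
  have s [simp]: "s a 1 = lam a 1" "s a 2 = lam a 2" "s a 3 = lam a 3" for a
    by (simp_all add: s_def)
  have chamber: "chamber 1 (s 1)" "chamber 1 (s 2)" "chamber 1 (s 3)"
    using nonneg[of 1 1] nonneg[of 2 1] nonneg[of 3 1] ordered[of 1] ordered[of 2] ordered[of 3]
      normalized[of 1] normalized[of 2] normalized[of 3] by (simp_all add: chamber_def)
  have ineqs: "?ineqs a b c \<longleftrightarrow> (\<forall>g\<in>slacks. 0 \<le> g (s a) (s b) (s c))" for a b c
    unfolding slacks_def ball_simps slack1_def slack2_def slack3_def slack4_def slack5_def slack6_def slack7_def s
    by (rule iffI; elim conjE; intro conjI TrueI; linarith)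
  show ?thesis
  proof
    assume ?states
    then obtain \<psi> where
      "\<forall>a\<in>{1, 2, 3}. eigenvalues_mset (reduced_density a \<psi>) = {#complex_of_real (s a 1), complex_of_real (s a 2), complex_of_real (s a 3)#}"
      unfolding s by blast
    then have "\<exists>t. diag_marginals t (s 1) (s 2) (s 3)" by (intro diag_marginals_of_state) blast+
    then have P: "polytope3 1 (s 1) (s 2) (s 3)" using polytope_of_diag_marginals chamber by blast
    show "\<forall>a b c. {a, b, c} = {1, 2, 3} \<longrightarrow> ?ineqs a b c"
    proof (intro allI impI)
      fix a b c :: nat assume "{a, b, c} = {1, 2, 3}"
      from triple_permutation[OF this] have "\<forall>g\<in>slacks. 0 \<le> g (s a) (s b) (s c)"
        using polytope3_slack[OF P] by blast
      then show "?ineqs a b c" unfolding ineqs .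
    qed
  next
    assume I: "\<forall>a b c. {a, b, c} = {1, 2, 3} \<longrightarrow> ?ineqs a b c"
    have slack: "0 \<le> g (s a) (s b) (s c)" if "g \<in> slacks" "{a, b, c} = {1, 2, 3}" for g and a b c :: nat
      using I[unfolded ineqs] that by blast
    have perms: "{1, 3, 2} = {1, 2, 3 :: nat}" "{2, 1, 3} = {1, 2, 3 :: nat}" "{2, 3, 1} = {1, 2, 3 :: nat}"
      "{3, 1, 2} = {1, 2, 3 :: nat}" "{3, 2, 1} = {1, 2, 3 :: nat}"
      by auto
    have "\<forall>h\<in>perm_slacks. 0 \<le> h (s 1) (s 2) (s 3)"
      using slack[OF _ refl] slack[OF _ perms(1)] slack[OF _ perms(2)] slack[OF _ perms(3)]
        slack[OF _ perms(4)] slack[OF _ perms(5)]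
      unfolding perm_slacks_def by blast
    then have "weight (s 1) (s 2) (s 3)"
      using weight_of_polytope chamber unfolding polytope3_def by blast
    then obtain f where f: "weight_function f (s 1) (s 2) (s 3)" "0 < f base_tensor"
      unfolding weight_def by blast
    have sum: "s 1 1 + s 1 2 + s 1 3 = 1" using normalized[of 1] by simp
    obtain t where t: "diag_marginals t (s 1) (s 2) (s 3)"
      using diag_marginals_of_weight_function[OF f sum] by blast
    obtain \<psi> where "three_qutrit_state \<psi>"
      "eigenvalues_mset (reduced_density 1 \<psi>) = {#complex_of_real (s 1 1), complex_of_real (s 1 2), complex_of_real (s 1 3)#}"
      "eigenvalues_mset (reduced_density 2 \<psi>) = {#complex_of_real (s 2 1), complex_of_real (s 2 2), complex_of_real (s 2 3)#}"
      "eigenvalues_mset (reduced_density 3 \<psi>) = {#complex_of_real (s 3 1), complex_of_real (s 3 2), complex_of_real (s 3 3)#}"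
      by (rule state_of_diag_marginals[OF t sum])
    then show ?states unfolding s by blast
  qed
qed

end
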